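(* Let $n>0$, $x>0$, $\delta\in\mathbb R$ and $y=x^2/(n+x^2)$. Let $c,d$ be real numbers with $0<y<c<1$ and $0<d<y<1$. Then $$F_n(x;\delta)=2P_n(x;\delta)+R_n(x;\delta),$$ where $$R_n(x;\delta)=\tfrac12\operatorname{erfc}\left(\delta/\sqrt2\right)+Q_n(x;\delta)-P_n(x;\delta)$$ $$=\tfrac12\operatorname{erfc}\left(\delta/\sqrt2\right)-\tfrac12e^{-\frac12\delta^2}\frac{\sqrt y\,(1-y)^{\frac12n}}{2\pi i}\int_{c-i\infty}^{c+i\infty}\frac{e^{\frac1{2t}\delta^2y}\operatorname{erfc}\left(\delta\sqrt{\frac{y}{2t}}\right)}{\sqrt t\,(1-t)^{\frac12n}(t-y)}\,dt$$ $$=\tfrac12e^{-\frac12\delta^2}\frac{\sqrt y\,(1-y)^{\frac12n}}{2\pi i}\int_{d-i\infty}^{d+i\infty}\frac{e^{\frac1{2t}\delta^2y}\operatorname{erfc}\left(\delta\sqrt{\frac{y}{2t}}\right)}{\sqrt t\,(1-t)^{\frac12n}(y-t)}\,dt .$$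
   Context: Notation. $\operatorname{erfc}(z)=\frac{2}{\sqrt\pi}\int_z^\infty e^{-t^2}dt$ (an entire function). $I_y(a,b)=\frac{1}{B(a,b)}\int_0^y t^{a-1}(1-t)^{b-1}dt$ is the normalized incomplete beta function, with $B(a,b)=\Gamma(a)\Gamma(b)/\Gamma(a+b)$. For $x\ge 0$, $\delta\in\mathbb R$, $n>0$ (not necessarily an integer), with $y=x^2/(n+x^2)$, the noncentral $t$-distribution is $$F_n(x;\delta)=\tfrac12\operatorname{erfc}\left(\delta/\sqrt2\right)+P_n(x;\delta)+Q_n(x;\delta),$$ $$P_n(x;\delta)=\tfrac12 e^{-\frac12\delta^2}\sum_{j=0}^\infty \frac{(\frac12\delta^2)^j}{j!}\, I_y\left(j+\tfrac12,\tfrac12 n\right),\qquad Q_n(x;\delta)=\tfrac12 e^{-\frac12\delta^2}\sum_{j=0}^\infty \frac{\delta}{\sqrt2}\frac{(\frac12\delta^2)^j}{\Gamma(j+\frac32)}\, I_y\left(j+1,\tfrac12 n\right).$$ The integrals are along the vertical lines $\Re t=c$ and $\Re t=d$; the multivalued functions $\sqrt t$ and $(1-t)^{n/2}$ are continuous on the path and take their principal values at the real point of the path. *)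

theory Defs
  imports "HOL-Analysis.Analysis"
begin

text \<open>The path from \<open>z\<close> to \<open>\<infinity>\<close> is the horizontal ray \<open>z + s\<close>, \<open>s \<ge> 0\<close>. The type is
  left general so that the same definition serves the real and the complex function.\<close>

definition erfc :: "'a::{real_normed_field, banach, second_countable_topology} \<Rightarrow> 'a" where
  "erfc z = of_real (2 / sqrt pi) *
     (LINT s:{0..}|lborel. exp (- ((z + of_real s)\<^sup>2)))"

definition inc_beta :: "real \<Rightarrow> real \<Rightarrow> real \<Rightarrow> real" where
  "inc_beta y a b = 1 / Beta a b *
     (LINT t:{0..y}|lborel. t powr (a - 1) * (1 - t) powr (b - 1))"

definition nct_P :: "real \<Rightarrow> real \<Rightarrow> real \<Rightarrow> real" where
  "nct_P n x \<delta> = (let y = x\<^sup>2 / (n + x\<^sup>2) in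
     1/2 * exp (- (\<delta>\<^sup>2 / 2)) *
       (\<Sum>j. (\<delta>\<^sup>2 / 2) ^ j / fact j * inc_beta y (real j + 1/2) (n / 2)))"

definition nct_Q :: "real \<Rightarrow> real \<Rightarrow> real \<Rightarrow> real" where
  "nct_Q n x \<delta> = (let y = x\<^sup>2 / (n + x\<^sup>2) in
     1/2 * exp (- (\<delta>\<^sup>2 / 2)) *
       (\<Sum>j. \<delta> / sqrt 2 * ((\<delta>\<^sup>2 / 2) ^ j / Gamma (real j + 3/2)) *
             inc_beta y (real j + 1) (n / 2)))"

definition nct_F :: "real \<Rightarrow> real \<Rightarrow> real \<Rightarrow> real" where
  "nct_F n x \<delta> = 1/2 * erfc (\<delta> / sqrt 2) + nct_P n x \<delta> + nct_Q n x \<delta>"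

definition nct_R :: "real \<Rightarrow> real \<Rightarrow> real \<Rightarrow> real" where
  "nct_R n x \<delta> = 1/2 * erfc (\<delta> / sqrt 2) + nct_Q n x \<delta> - nct_P n x \<delta>"

text \<open>Integration over the line \<open>Re t = c\<close>, oriented upwards; the factor \<open>\<i>\<close> is the derivative
  of the parametrization \<open>t = c + \<i> s\<close>.\<close>

definition vline_integrable :: "real \<Rightarrow> (complex \<Rightarrow> complex) \<Rightarrow> bool" where
  "vline_integrable c f \<longleftrightarrow> integrable lborel (\<lambda>s::real. f (Complex c s))"

definition vline_integral :: "real \<Rightarrow> (complex \<Rightarrow> complex) \<Rightarrow> complex" where
  "vline_integral c f = \<i> * (LINT s|lborel. f (Complex c s))"

text \<open>The numerator and the two multivalued factors common to both line integrals. For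
  \<open>0 < Re t < 1\<close> all of \<open>t\<close>, \<open>1 - t\<close> and \<open>y / (2 t)\<close> lie in the right half-plane, where the
  principal branches \<^const>\<open>csqrt\<close> and \<^const>\<open>powr\<close> are continuous; so on each of the lines used
  they are the continuous branches that are principal at the real point.\<close>

definition nct_kernel :: "real \<Rightarrow> real \<Rightarrow> real \<Rightarrow> complex \<Rightarrow> complex" where
  "nct_kernel n \<delta> y t =
     exp (1 / (2 * t) * of_real (\<delta>\<^sup>2 * y)) *
       erfc (of_real \<delta> * csqrt (of_real y / (2 * t))) /
     (csqrt t * (1 - t) powr of_real (n / 2))"

end

theory Submission
  imports Defs "HOL-Probability.Probability"
begin

text \<open>
  The entire function \<open>exp (w\<^sup>2) erfc w\<close> has the power series \<open>\<Sum>k. (- w)\<^sup>k / \<Gamma> (k/2 + 1)\<close>. With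
  \<open>w = \<delta> sqrt (y / (2 t))\<close> its even part produces the series of \<open>P\<close> and its odd part that of
  \<open>- Q\<close>, provided that for \<open>t\<close> on a line to the right of \<open>y\<close>
  \<open>I\<^sub>y(a,b) = y\<^sup>a (1 - y)\<^sup>b / (2 \<pi> i) \<integral> t\<^sup>-\<^sup>a (1 - t)\<^sup>-\<^sup>b / (t - y) dt\<close>.
  Both sides of this identity satisfy the same recurrence \<open>a \<mapsto> a + 1\<close> and tend to 0 as
  \<open>a \<rightarrow> \<infinity>\<close>. The inhomogeneous term of the recurrence is Cauchy's beta integral
  \<open>\<integral> t\<^sup>-\<^sup>a (1 - t)\<^sup>-\<^sup>b dt\<close>, a Parseval identity for two gamma densities. On a line to the left of
  \<open>y\<close> the substitution \<open>t \<mapsto> 1 - t\<close> and \<open>I\<^bsub>1-y\<^esub>(b,a) = 1 - I\<^sub>y(a,b)\<close> give the value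
  \<open>I\<^sub>y(a,b) - 1\<close> instead, so that no contour has to be shifted across the pole.
\<close>

section \<open>The gamma integral with complex rate\<close>

text \<open>The exponential series is integrated term by term: all partial sums of the norms stay
  below \<open>exp (norm z * \<bar>u\<bar>) * \<bar>g u\<bar>\<close>. It serves twice, with a
  half-line Gaussian as \<open>g\<close> for \<open>erfc\<close> (real and complex) and with a gamma
  density as \<open>g\<close> for complex rates.\<close>

lemma
  fixes z :: "'a::{real_normed_field, banach, second_countable_topology}" and g :: "real \<Rightarrow> real"
  assumes [measurable]: "g \<in> borel_measurable borel"
    and int: "integrable lborel (\<lambda>u. exp (norm z * \<bar>u\<bar>) * g u)"
  shows integrable_exp_transform: "integrable lborel (\<lambda>u. of_real (g u) * exp (of_real u * z))"
    and sums_exp_transform: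
      "(\<lambda>k. z ^ k / of_real (fact k) * of_real (LINT u|lborel. u ^ k * g u)) sums
         (LINT u|lborel. of_real (g u) * exp (of_real u * z))"
proof -
  define F where "F = (\<lambda>k u. of_real (g u) * (of_real u * z) ^ k /\<^sub>R fact k)"
  have F_meas [measurable]: "F k \<in> borel_measurable lborel" for k
    unfolding F_def by measurable
  have normF: "norm (F k u) = \<bar>g u\<bar> * ((norm z * \<bar>u\<bar>) ^ k /\<^sub>R fact k)" for k u
    by (simp add: F_def norm_mult norm_power mult_ac)
  have exp_sums: "(\<lambda>k. norm (F k u)) sums (\<bar>g u\<bar> * exp (norm z * \<bar>u\<bar>))" for u
    unfolding normF by (intro sums_mult exp_converges)
  have partial: "(\<Sum>k<N. norm (F k u)) \<le> norm (exp (norm z * \<bar>u\<bar>) * g u)" for N u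
    using sum_le_suminf[of "\<lambda>k. norm (F k u)" "{..<N}"] exp_sums[of u]
    by (simp add: sums_iff abs_mult mult_ac)
  have intF: "integrable lborel (F k)" for k
  proof (rule Bochner_Integration.integrable_bound[OF int])
    have "norm (F k u) \<le> norm (exp (norm z * \<bar>u\<bar>) * g u)" for u
      using member_le_sum[of k "{..<Suc k}" "\<lambda>k. norm (F k u)"] partial[where N = "Suc k" and u = u] by auto
    thus "AE u in lborel. norm (F k u) \<le> norm (exp (norm z * \<bar>u\<bar>) * g u)" by simp
  qed simp
  have summ: "summable (\<lambda>k. LINT u|lborel. norm (F k u))"
  proof (rule summableI_nonneg_bounded)
    fix N
    have "(\<Sum>k<N. LINT u|lborel. norm (F k u)) = (LINT u|lborel. (\<Sum>k<N. norm (F k u)))"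
      by (subst Bochner_Integration.integral_sum) (auto intro: integrable_norm intF)
    also have "\<dots> \<le> (LINT u|lborel. norm (exp (norm z * \<bar>u\<bar>) * g u))"
      by (intro integral_mono Bochner_Integration.integrable_sum integrable_norm intF int partial)
    finally show "(\<Sum>k<N. LINT u|lborel. norm (F k u)) \<le> \<dots>" .
  qed simp
  have AEs: "AE u in lborel. summable (\<lambda>k. norm (F k u))"
    using exp_sums by (auto simp: sums_iff)
  have sumF: "(\<Sum>k. F k u) = of_real (g u) * exp (of_real u * z)" for u
  proof -
    have "(\<lambda>k. F k u) sums (of_real (g u) * exp (of_real u * z))"
      unfolding F_def
      using sums_mult[OF exp_converges, of "of_real (g u)" "of_real u * z"] by simp
    thus ?thesis by (simp add: sums_iff)
  qed
  show "integrable lborel (\<lambda>u. of_real (g u) * exp (of_real u * z))"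
    using integrable_suminf[OF intF AEs summ] by (simp add: sumF)
  have intFk: "integral\<^sup>L lborel (F k) = z ^ k / of_real (fact k) * of_real (LINT u|lborel. u ^ k * g u)" for k
  proof -
    have eq: "F k = (\<lambda>u. z ^ k / of_real (fact k) * of_real (u ^ k * g u))"
      by (rule ext) (simp add: F_def scaleR_conv_of_real power_mult_distrib field_simps)
    \<comment> \<open>For \<open>z ^ k \<noteq> 0\<close> the moment is integrable because it is a
      multiple of \<open>F k\<close>. If \<open>z ^ k = 0\<close>, it may fail to be integrable, but
      then both sides vanish whatever the value of its integral.\<close>
    show ?thesis
    proof (cases "z ^ k = 0")
      case False
      have "(\<lambda>u. of_real (u ^ k * g u) :: 'a) = (\<lambda>u. (of_real (fact k) / z ^ k) * F k u)"
        using False by (simp only: eq fun_eq_iff) (auto simp: divide_simps)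
      hence "integrable lborel (\<lambda>u. of_real (u ^ k * g u) :: 'a)"
        by (simp only: integrable_mult_right[OF intF])
      hence "integrable lborel (\<lambda>u. norm (of_real (u ^ k * g u) :: 'a))"
        by (rule integrable_norm)
      hence "integrable lborel (\<lambda>u. norm (u ^ k * g u))"
        by (simp only: norm_of_real real_norm_def)
      hence "integrable lborel (\<lambda>u. u ^ k * g u)"
        by (rule integrable_norm_cancel) simp
      thus ?thesis
        unfolding eq integral_mult_right_zero
        by (subst integral_bounded_linear[OF bounded_linear_of_real]) auto
    qed (auto simp: eq)
  qed
  show "(\<lambda>k. z ^ k / of_real (fact k) * of_real (LINT u|lborel. u ^ k * g u)) sums
         (LINT u|lborel. of_real (g u) * exp (of_real u * z))"
    using sums_integral[OF intF AEs summ] by (simp add: sumF intFk)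
qed

text \<open>Completing the square, \<open>r * u - u^2 = r^2 / 4 - (u - r / 2)^2\<close>, gives a
  multiple of a normal density with mean \<open>r / 2\<close> as majorant.\<close>

lemma integrable_exp_gaussian:
  "integrable lborel (\<lambda>u::real. exp (r * \<bar>u\<bar>) * (indicator {0..} u * exp (- u\<^sup>2)))"
proof -
  have "normal_density (r / 2) (1 / sqrt 2) u * sqrt pi = exp (- (u - r / 2)\<^sup>2)" for u
    by (simp add: normal_density_def power_divide)
  hence "integrable lborel (\<lambda>u. exp (r\<^sup>2 / 4) * exp (- (u - r / 2)\<^sup>2))"
    using integrable_mult_left[OF integrable_normal_density[of "1 / sqrt 2" "r / 2"], of "sqrt pi"]
    by (intro integrable_mult_right) simp
  thus ?thesis
    by (rule Bochner_Integration.integrable_bound)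
      (auto simp: indicator_def exp_add [symmetric] power2_eq_square algebra_simps)
qed

lemma gamma_rate_has_bochner_integral:
  fixes a r :: real
  assumes a: "a > 0" and r: "r > 0"
  shows "has_bochner_integral lborel (\<lambda>u. indicator {0..} u * u powr (a - 1) * exp (- r * u))
           (Gamma a / r powr a)"
proof -
  have "has_bochner_integral lborel (\<lambda>u. indicator {0..} u * u powr (a - 1) * exp (- u)) (Gamma a)"
    using Gamma_conv_nn_integral_real[OF a] a
    by (intro has_bochner_integral_nn_integral) (auto simp: exp_minus field_simps)
  from lborel_has_bochner_integral_real_affine_iff[of r _ _ 0, THEN iffD1, OF _ this] r
  have "has_bochner_integral lborel
      (\<lambda>u. r powr (1 - a) * (indicator {0..} (r * u) * (r * u) powr (a - 1) * exp (- (r * u))))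
      (r powr (1 - a) * (Gamma a / r))"
    by (intro has_bochner_integral_mult_right) (simp add: divide_inverse mult.commute)
  also have "(\<lambda>u. r powr (1 - a) * (indicator {0..} (r * u) * (r * u) powr (a - 1) * exp (- (r * u))))
      = (\<lambda>u. indicator {0..} u * u powr (a - 1) * exp (- r * u))"
    using r by (auto simp: fun_eq_iff indicator_def zero_le_mult_iff powr_mult powr_diff powr_minus field_simps)
  also have "r powr (1 - a) * (Gamma a / r) = Gamma a / r powr a"
    using r by (simp add: powr_diff)
  finally show ?thesis .
qed

text \<open>The real rate \<open>r\<close> is perturbed to \<open>t = r - z\<close>: expanding
  \<open>exp (z * u)\<close> against the gamma density of rate \<open>r\<close> gives a binomial
  series. At \<open>t\<close> and \<open>1 - t\<close> on a vertical line these integrals are the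
  Fourier transforms behind Cauchy's beta integral.\<close>

lemma complex_gamma_rate_has_bochner_integral:
  fixes a :: real and t :: complex
  assumes a: "a > 0" and t: "Re t > 0"
  shows "has_bochner_integral lborel
           (\<lambda>u. of_real (indicator {0..} u * u powr (a - 1)) * exp (- t * of_real u))
           (of_real (Gamma a) * t powr (- of_real a))"
proof -
  \<comment> \<open>A disc around \<open>r\<close> of radius less than \<open>r\<close> contains \<open>t\<close>, and there the binomial series applies.\<close>
  define r where "r = (cmod t)\<^sup>2 / Re t"
  have t0: "cmod t > 0" using t by auto
  have r: "r > 0" using t t0 by (simp add: r_def)
  define g where "g = (\<lambda>u::real. indicator {0..} u * u powr (a - 1) * exp (- r * u))"
  define z where "z = of_real r - t"
  have [measurable]: "g \<in> borel_measurable borel" unfolding g_def by measurable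
  \<comment> \<open>The choice of \<open>r\<close> makes \<open>r * Re t\<close> equal to the square
    of \<open>cmod t\<close>, so the right side collapses to \<open>r^2\<close> minus that
    square.\<close>
  have "(cmod z)\<^sup>2 = r\<^sup>2 - 2 * (r * Re t) + (cmod t)\<^sup>2"
    by (simp add: z_def cmod_power2 power2_diff algebra_simps)
  also have "r * Re t = (cmod t)\<^sup>2" using t by (simp add: r_def)
  finally have "(cmod z)\<^sup>2 < r\<^sup>2" using t0 by simp
  hence z: "cmod z < r" using r by (simp add: power_less_imp_less_base)
  have "integrable lborel (\<lambda>u. exp (cmod z * \<bar>u\<bar>) * g u)"
  proof -
    have "exp (cmod z * \<bar>u\<bar>) * g u = indicator {0..} u * u powr (a - 1) * exp (- (r - cmod z) * u)" for u
      by (auto simp: g_def indicator_def mult_exp_exp algebra_simps)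
    thus ?thesis
      using gamma_rate_has_bochner_integral[of a "r - cmod z"] a z
      by (simp add: has_bochner_integral_iff)
  qed
  note * = integrable_exp_transform[OF _ this] sums_exp_transform[OF _ this]
  have eq: "of_real (g u) * exp (of_real u * z)
      = of_real (indicator {0..} u * u powr (a - 1)) * exp (- t * of_real u)" for u
    by (simp add: g_def z_def exp_of_real mult_exp_exp algebra_simps flip: exp_of_real)
  have int: "integrable lborel (\<lambda>u. of_real (indicator {0..} u * u powr (a - 1)) * exp (- t * of_real u))"
    using *(1) by (simp add: eq)
  have "(LINT u|lborel. u ^ k * g u) = Gamma (a + k) / r powr (a + k)" for k
  proof -
    have "u ^ k * g u = indicator {0..} u * u powr (a + k - 1) * exp (- r * u)" for u
      by (cases "u > 0") (auto simp: g_def indicator_def powr_diff powr_add powr_realpow)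
    thus ?thesis
      using gamma_rate_has_bochner_integral[of "a + k" r] a r
      by (simp add: has_bochner_integral_iff)
  qed
  with *(2) have "(\<lambda>k. z ^ k / of_real (fact k) * of_real (Gamma (a + k) / r powr (a + k))) sums
      (LINT u|lborel. of_real (indicator {0..} u * u powr (a - 1)) * exp (- t * of_real u))"
    by (simp add: eq)
  moreover have "(\<lambda>k. z ^ k / of_real (fact k) * of_real (Gamma (a + k) / r powr (a + k))) sums
      (of_real (Gamma a) * t powr (- of_real a))"
  \<comment> \<open>Since \<open>t = r * (1 - z / r)\<close>, the target is
    \<open>Gamma a / r powr a\<close> times the binomial series of
    \<open>(1 - z / r) powr (- a)\<close>, whose coefficients are Pochhammer symbols and hence
    quotients of Gamma values.\<close>
  proof -
    have "cmod (- z / of_real r) < 1" using z r by (simp add: norm_divide)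
    from sums_mult[OF gen_binomial_complex[OF this, of "- of_real a"], of "of_real (Gamma a / r powr a)"]
    have "(\<lambda>k. of_real (Gamma a / r powr a) * ((- of_real a gchoose k) * (- z / of_real r) ^ k)) sums
       (of_real (Gamma a / r powr a) * (1 + - z / of_real r) powr - of_real a)" .
    moreover have "of_real (Gamma a / r powr a) * (1 + - z / of_real r) powr - of_real a
        = of_real (Gamma a) * t powr - of_real a"
    proof -
      have "1 + - z / of_real r = of_real (1 / r) * t" using r by (simp add: z_def field_simps)
      hence "(1 + - z / of_real r) powr - of_real a = of_real (1 / r) powr - of_real a * t powr - of_real a"
        using r by (simp only:) (intro powr_times_real_left, auto)
      also have "of_real (1 / r) powr - of_real a = complex_of_real (r powr a)"
        using r powr_of_real[of "1 / r" "- a"] by (simp add: powr_divide powr_minus field_simps)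
      finally show ?thesis using r by simp
    qed
    moreover have "of_real (Gamma a / r powr a) * ((- of_real a gchoose k) * (- z / of_real r) ^ k)
        = z ^ k / of_real (fact k) * of_real (Gamma (a + k) / r powr (a + k))" for k
    proof -
      have "(- complex_of_real a gchoose k) = (- 1) ^ k * of_real (pochhammer a k / fact k :: real)"
        by (simp add: gbinomial_pochhammer pochhammer_of_real)
      moreover have "pochhammer a k = Gamma (a + k) / Gamma a"
        using a by (intro pochhammer_Gamma) (auto elim!: nonpos_Ints_cases)
      moreover have "Gamma a \<noteq> 0" using Gamma_real_pos[OF a] by linarith
      ultimately have "of_real (Gamma a) * (- complex_of_real a gchoose k)
          = (- 1) ^ k * of_real (Gamma (a + k)) / of_real (fact k)"
        by simp
      moreover have "(- z / of_real r) ^ k = (- 1) ^ k * (z ^ k / of_real r ^ k)"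
        using power_mult_distrib[of "- 1" "z / of_real r" k] by (simp add: power_divide)
      ultimately have "of_real (Gamma a) * (- complex_of_real a gchoose k) * (- z / of_real r) ^ k
          = z ^ k * of_real (Gamma (a + k)) / of_real (fact k) / of_real r ^ k"
        by (simp only:) (cases "even k", simp_all add: mult_ac)
      thus ?thesis using r by (simp add: powr_add powr_realpow field_simps)
    qed
    ultimately show ?thesis by simp
  qed
  ultimately show ?thesis using int
    by (simp add: has_bochner_integral_iff sums_iff)
qed

section \<open>The power series of the scaled error function\<close>

text \<open>The Taylor coefficients of the scaled error function, a form of Mills' ratio. They are
  kept as Gaussian moments here; their closed form depends on the parity of
  \<open>k\<close>.\<close>

definition mills_coeff :: "nat \<Rightarrow> real" where
  "mills_coeff k = 2 / sqrt pi * ((-2) ^ k / fact k) * (LINT u|lborel. u ^ k * (indicator {0..} u * exp (- u\<^sup>2)))"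

text \<open>Multiplying by \<open>exp (z^2)\<close> cancels the quadratic term in \<open>z\<close>
  of the integrand and leaves \<open>exp (- u^2) * exp (- 2 * z * u)\<close>, an exponential
  transform of the half-line Gaussian at \<open>- 2 * z\<close>.\<close>

lemma exp_square_mult_erfc_sums:
  fixes z :: "'a::{real_normed_field, banach, second_countable_topology}"
  shows "(\<lambda>k. of_real (mills_coeff k) * z ^ k) sums (exp (z\<^sup>2) * erfc z)"
proof -
  let ?g = "\<lambda>u::real. indicator {0..} u * exp (- u\<^sup>2)"
  have "(\<lambda>k. of_real (2 / sqrt pi) * ((-2 * z) ^ k / of_real (fact k) * of_real (LINT u|lborel. u ^ k * ?g u))) sums
         (of_real (2 / sqrt pi) * (LINT u|lborel. of_real (?g u) * exp (of_real u * (-2 * z))))"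
    by (intro sums_mult sums_exp_transform integrable_exp_gaussian) measurable
  also have "(\<lambda>k. of_real (2 / sqrt pi) * ((-2 * z) ^ k / of_real (fact k) * of_real (LINT u|lborel. u ^ k * ?g u)))
      = (\<lambda>k. of_real (mills_coeff k) * z ^ k)"
    by (rule ext, subst power_mult_distrib) (simp add: mills_coeff_def)
  also have "of_real (2 / sqrt pi) * (LINT u|lborel. of_real (?g u) * exp (of_real u * (-2 * z))) = exp (z\<^sup>2) * erfc z"
  proof -
    have "of_real (?g u) * exp (of_real u * (-2 * z)) = exp (z\<^sup>2) * (indicator {0..} u *\<^sub>R exp (- ((z + of_real u)\<^sup>2)))" for u
      by (auto simp: indicator_def mult_exp_exp power2_eq_square algebra_simps simp flip: exp_of_real)
    thus ?thesis unfolding erfc_def set_lebesgue_integral_def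
      by (simp only: integral_mult_right_zero) simp
  qed
  finally show ?thesis .
qed

text \<open>The duplication formula at half-integers, by induction along
  \<open>Gamma (z + 1) = z * Gamma z\<close>. The factorials are those that the odd coefficients
  contain.\<close>

lemma Gamma_nat_plus_three_halves:
  "Gamma (real j + 3 / 2) = fact (2 * j + 1) * sqrt pi / (2 ^ (2 * j + 1) * fact j)"
proof (induction j)
  case 0
  have "(1 / 2 :: real) \<notin> \<int>\<^sub>\<le>\<^sub>0" by (auto elim!: nonpos_Ints_cases)
  from Gamma_plus1[OF this] show ?case using Gamma_one_half_real by simp
next
  case (Suc j)
  have "Gamma (real (Suc j) + 3 / 2) = Gamma ((real j + 3 / 2) + 1)" by (simp add: algebra_simps)
  also have "\<dots> = (real j + 3 / 2) * Gamma (real j + 3 / 2)"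
    by (intro Gamma_plus1) (auto elim!: nonpos_Ints_cases)
  finally have 1: "Gamma (real (Suc j) + 3 / 2) =
      (real j + 3 / 2) * (fact (2 * j + 1) * sqrt pi / (2 ^ (2 * j + 1) * fact j))" unfolding Suc .
  have 2: "fact (2 * Suc j + 1) = (2 * real j + 3) * (2 * (real j + 1)) * fact (2 * j + 1)"
    by (simp add: algebra_simps)
  have 3: "(2::real) ^ (2 * Suc j + 1) * fact (Suc j) = 4 * (real j + 1) * (2 ^ (2 * j + 1) * fact j)"
    by (simp add: algebra_simps)
  have "real j + 1 \<noteq> 0" by simp
  thus ?case unfolding 1 2 3 by (simp add: divide_simps)
qed

lemma mills_coeff_even: "mills_coeff (2 * j) = 1 / fact j"
proof -
  have "(LINT u|lborel. u ^ (2 * j) * (indicator {0..} u * exp (- u\<^sup>2))) = sqrt pi / 2 * (fact (2 * j) / (2 ^ (2 * j) * fact j))"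
    using gaussian_moment_even_pos[of j] by (simp add: has_bochner_integral_iff mult_ac)
  thus ?thesis unfolding mills_coeff_def by (simp add: power_mult)
qed

lemma mills_coeff_odd: "mills_coeff (2 * j + 1) = - 1 / Gamma (real j + 3 / 2)"
proof -
  have *: "(LINT u|lborel. u ^ (2 * j + 1) * (indicator {0..} u * exp (- u\<^sup>2))) = (fact j / 2 :: real)"
    using gaussian_moment_odd_pos[of j] by (simp add: has_bochner_integral_iff mult_ac)
  show ?thesis unfolding mills_coeff_def * Gamma_nat_plus_three_halves
    by (simp add: divide_simps del: fact_Suc)
qed

section \<open>Cauchy's beta integral\<close>

lemma fourier_std_normal_density:
  "(LINT x|lborel. complex_of_real (std_normal_density x) * iexp (z * x)) = of_real (sqrt (2 * pi) * std_normal_density z)"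
  "integrable lborel (\<lambda>x. complex_of_real (std_normal_density x) * iexp (z * x))"
proof -
  have "(LINT x|lborel. complex_of_real (std_normal_density x) * iexp (z * x)) = char std_normal_distribution z"
    unfolding char_def by (subst integral_density) (auto simp: scaleR_conv_of_real)
  thus "(LINT x|lborel. complex_of_real (std_normal_density x) * iexp (z * x)) = of_real (sqrt (2 * pi) * std_normal_density z)"
    unfolding char_std_normal_distribution by (simp add: std_normal_density_def)
  show "integrable lborel (\<lambda>x. complex_of_real (std_normal_density x) * iexp (z * x))"
    by (rule Bochner_Integration.integrable_bound[OF integrable_normal_density[of 1 0]]) (auto simp: norm_mult)
qed

text \<open>The Gaussian is its own Fourier transform up to a factor, so averaging \<open>h\<close>
  around \<open>v\<close> against a narrow Gaussian equals inverting its transform with a Gaussian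
  damping factor. Dominated convergence removes the Gaussian on both sides; continuity of
  \<open>h\<close> gives the value at every \<open>v\<close>.\<close>

lemma fourier_inversion:
  fixes h :: "real \<Rightarrow> real" and v :: real
  assumes int: "integrable lborel h"
    and cont: "continuous_on UNIV h" and bdd: "\<And>u. \<bar>h u\<bar> \<le> M"
    and intF: "integrable lborel (\<lambda>s. LINT u|lborel. of_real (h u) * iexp (- s * u))"
  shows "(LINT s|lborel. (LINT u|lborel. of_real (h u) * iexp (- s * u)) * iexp (s * v)) = 2 * pi * h v"
proof -
  define F where "F = (\<lambda>s. LINT u|lborel. complex_of_real (h u) * iexp (- s * u))"
  have [measurable]: "h \<in> borel_measurable borel" using int by auto
  have [measurable]: "F \<in> borel_measurable borel" using intF unfolding F_def by auto
  define \<phi> where "\<phi> = std_normal_density"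
  have [measurable]: "\<phi> \<in> borel_measurable borel" unfolding \<phi>_def by simp
  have \<phi>_int: "integrable lborel \<phi>" unfolding \<phi>_def by simp
  \<comment> \<open>Regularize by a Gaussian of variance \<open>\<sigma>\<^sub>k\<^sup>2\<close> and let \<open>\<sigma>\<^sub>k \<rightarrow> 0\<close>.\<close>
  define \<sigma> where "\<sigma> = (\<lambda>k. 1 / real (Suc k))"
  have \<sigma>: "\<sigma> k > 0" for k by (simp add: \<sigma>_def)
  have \<sigma>0: "\<sigma> \<longlonglongrightarrow> 0" unfolding \<sigma>_def by (rule LIMSEQ_Suc[OF lim_1_over_n])
  \<comment> \<open>Write \<open>\<phi> z\<close> as a Fourier integral of \<open>\<phi>\<close>,
    exchange the two integrals by Fubini, and rescale the outer variable to
    \<open>x = \<sigma> k * s\<close>.\<close>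
  have key: "(LINT z|lborel. complex_of_real (h (v - \<sigma> k * z) * \<phi> z)) =
      (LINT s|lborel. of_real (\<phi> (\<sigma> k * s)) * (F s * iexp (s * v))) / sqrt (2 * pi)" for k
  proof -
    let ?G = "\<lambda>z x. complex_of_real (h (v - \<sigma> k * z)) * (of_real (\<phi> x) * iexp (z * x))"
    have inth: "integrable lborel (\<lambda>z. h (v - \<sigma> k * z))"
      using lborel_integrable_real_affine[OF int, of "- \<sigma> k" v] \<sigma>[of k] by simp
    have "integrable (lborel \<Otimes>\<^sub>M lborel) (\<lambda>(z, x). ?G z x)"
    proof (rule lborel_pair.Fubini_integrable)
      have "(\<lambda>z. LINT x|lborel. norm ((\<lambda>(z, x). ?G z x) (z, x))) = (\<lambda>z. \<bar>h (v - \<sigma> k * z)\<bar> * (LINT x|lborel. \<bar>\<phi> x\<bar>))"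
        by (simp add: norm_mult)
      thus "integrable lborel (\<lambda>z. LINT x|lborel. norm ((\<lambda>(z, x). ?G z x) (z, x)))"
        using inth by simp
      show "AE z in lborel. integrable lborel (\<lambda>x. (\<lambda>(z, x). ?G z x) (z, x))"
        using fourier_std_normal_density(2) by (simp add: \<phi>_def)
    qed measurable
    from lborel_pair.Fubini_integral[OF this]
    have "(LINT x|lborel. LINT z|lborel. ?G z x) = (LINT z|lborel. LINT x|lborel. ?G z x)" .
    also have "(\<lambda>z. LINT x|lborel. ?G z x) = (\<lambda>z. of_real (sqrt (2 * pi)) * of_real (h (v - \<sigma> k * z) * \<phi> z))"
      unfolding integral_mult_right_zero \<phi>_def fourier_std_normal_density(1) by (simp add: mult_ac)
    finally have 1: "(LINT x|lborel. LINT z|lborel. ?G z x) =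
        of_real (sqrt (2 * pi)) * (LINT z|lborel. complex_of_real (h (v - \<sigma> k * z) * \<phi> z))" by simp
    have 2: "(LINT z|lborel. ?G z (\<sigma> k * s)) = of_real (1 / \<sigma> k) * (of_real (\<phi> (\<sigma> k * s)) * (F s * iexp (s * v)))" for s
    proof -
      \<comment> \<open>Substitution \<open>u = v - \<sigma> k * z\<close>, which turns
        \<open>iexp (- s * u)\<close> into the phase needed in \<open>?G\<close> up to the factor
        \<open>iexp (s * v)\<close>.\<close>
      have "F s = \<sigma> k * (LINT z|lborel. complex_of_real (h (v - \<sigma> k * z)) * iexp (- s * (v - \<sigma> k * z)))"
        unfolding F_def using \<sigma>[of k]
        by (subst lborel_integral_real_affine[of "- \<sigma> k" _ v]) (auto simp: scaleR_conv_of_real)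
      hence "of_real (1 / \<sigma> k) * (of_real (\<phi> (\<sigma> k * s)) * (F s * iexp (s * v))) =
         (LINT z|lborel. complex_of_real (h (v - \<sigma> k * z)) * iexp (- s * (v - \<sigma> k * z))) * (of_real (\<phi> (\<sigma> k * s)) * iexp (s * v))"
        using \<sigma>[of k] by simp
      also have "\<dots> = (LINT z|lborel. complex_of_real (h (v - \<sigma> k * z)) * iexp (- s * (v - \<sigma> k * z)) * (of_real (\<phi> (\<sigma> k * s)) * iexp (s * v)))"
        by (rule integral_mult_left_zero[symmetric])
      also have "\<dots> = (LINT z|lborel. ?G z (\<sigma> k * s))"
        by (intro Bochner_Integration.integral_cong) (auto simp: mult_exp_exp algebra_simps)
      finally show ?thesis ..
    qed
    have "(LINT x|lborel. LINT z|lborel. ?G z x) = \<sigma> k * (LINT s|lborel. LINT z|lborel. ?G z (\<sigma> k * s))"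
      using \<sigma>[of k] by (subst lborel_integral_real_affine[of "\<sigma> k" _ 0]) (auto simp: scaleR_conv_of_real)
    also have "\<dots> = (LINT s|lborel. of_real (\<phi> (\<sigma> k * s)) * (F s * iexp (s * v)))"
      unfolding 2 integral_mult_right_zero using \<sigma>[of k] by simp
    finally show ?thesis using 1 by (simp add: field_simps)
  qed
  have "(\<lambda>k. LINT z|lborel. complex_of_real (h (v - \<sigma> k * z) * \<phi> z)) \<longlonglongrightarrow> (LINT z|lborel. complex_of_real (h v * \<phi> z))"
  proof (rule integral_dominated_convergence[where w = "\<lambda>z. M * \<phi> z"])
    have "(\<lambda>k. h (v - \<sigma> k * z)) \<longlonglongrightarrow> h v" for z
    proof -
      have "(\<lambda>k. v - \<sigma> k * z) \<longlonglongrightarrow> v - 0 * z" by (intro tendsto_intros \<sigma>0)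
      thus ?thesis using cont by (auto intro: isCont_tendsto_compose simp: continuous_on_eq_continuous_at)
    qed
    thus "AE z in lborel. (\<lambda>k. complex_of_real (h (v - \<sigma> k * z) * \<phi> z)) \<longlonglongrightarrow> complex_of_real (h v * \<phi> z)"
      by (intro AE_I2 tendsto_intros)
    show "AE z in lborel. norm (complex_of_real (h (v - \<sigma> k * z) * \<phi> z)) \<le> M * \<phi> z" for k
      using bdd by (auto simp: norm_mult abs_mult \<phi>_def intro!: mult_mono order_trans[OF abs_ge_zero bdd])
  qed (use \<phi>_int in auto)
  moreover have "(\<lambda>k. (LINT s|lborel. of_real (\<phi> (\<sigma> k * s)) * (F s * iexp (s * v))) / sqrt (2 * pi))
       \<longlonglongrightarrow> (LINT s|lborel. of_real (\<phi> 0) * (F s * iexp (s * v))) / sqrt (2 * pi)"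
  proof (intro tendsto_intros, rule integral_dominated_convergence[where w = "\<lambda>s. \<phi> 0 * norm (F s)"])
    have "(\<lambda>k. \<phi> (\<sigma> k * s)) \<longlonglongrightarrow> \<phi> 0" for s
    proof -
      have "(\<lambda>k. \<sigma> k * s) \<longlonglongrightarrow> 0 * s" by (intro tendsto_intros \<sigma>0)
      moreover have "isCont \<phi> 0" unfolding \<phi>_def std_normal_density_def by (intro continuous_intros) auto
      ultimately show ?thesis by (auto intro: isCont_tendsto_compose)
    qed
    thus "AE s in lborel. (\<lambda>k. complex_of_real (\<phi> (\<sigma> k * s)) * (F s * iexp (s * v))) \<longlonglongrightarrow> of_real (\<phi> 0) * (F s * iexp (s * v))"
      by (intro AE_I2 tendsto_intros)
    show "AE s in lborel. norm (complex_of_real (\<phi> (\<sigma> k * s)) * (F s * iexp (s * v))) \<le> \<phi> 0 * norm (F s)" for k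
      by (intro AE_I2) (auto simp: norm_mult norm_divide \<phi>_def std_normal_density_def intro!: mult_left_le_one_le divide_right_mono)
  qed (use intF in \<open>auto simp: F_def\<close>)
  ultimately have "(LINT z|lborel. complex_of_real (h v * \<phi> z)) = (LINT s|lborel. of_real (\<phi> 0) * (F s * iexp (s * v))) / sqrt (2 * pi)"
    unfolding key by (rule LIMSEQ_unique)
  also have "(LINT z|lborel. complex_of_real (h v * \<phi> z)) = h v"
    unfolding integral_complex_of_real by (simp add: \<phi>_def)
  also have "(LINT s|lborel. of_real (\<phi> 0) * (F s * iexp (s * v))) / sqrt (2 * pi) = (LINT s|lborel. F s * iexp (s * v)) / (2 * pi)"
  proof -
    \<comment> \<open>\<open>\<phi> 0 = 1 / sqrt (2 * pi)\<close> joins the equal factor from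
      \<open>key\<close> to make the constant \<open>1 / (2 * pi)\<close>.\<close>
    have \<phi>0: "complex_of_real (\<phi> 0) / sqrt (2 * pi) = 1 / (2 * pi)"
      by (simp add: \<phi>_def std_normal_density_def flip: of_real_mult)
    show ?thesis
      unfolding integral_mult_right_zero times_divide_eq_left [of "of_real (\<phi> 0)", symmetric] \<phi>0
      by simp
  qed
  finally have "(LINT s|lborel. F s * iexp (s * v)) = of_real (2 * pi * h v)" by simp
  thus ?thesis by (simp only: F_def)
qed

section \<open>Powers on vertical lines\<close>

lemma integrable_norm_line_powr:
  assumes p: "p > (1::real)" and c: "c > 0"
  shows "integrable lborel (\<lambda>s. norm (Complex c s) powr (- p))"
proof -
  have 1: "integrable lborel (\<lambda>s::real. indicator {1..} s * s powr (- p))"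
  proof (rule integrableI_nonneg)
    show "(\<integral>\<^sup>+ s. ennreal (indicator {1..} s * s powr (- p)) \<partial>lborel) < \<infinity>"
      using nn_integral_has_integral_lebesgue[OF _ has_integral_powr_to_inf[of "- p" 1]] p by simp
  qed auto
  have 2: "integrable lborel (\<lambda>s::real. indicator {1..} (- s) * (- s) powr (- p))"
    using lborel_integrable_real_affine[OF 1, of "- 1" 0] by simp
  have "integrable lborel (\<lambda>s::real. indicator {-1..1} s * c powr (- p) + indicator {1..} s * s powr (- p)
      + indicator {1..} (- s) * (- s) powr (- p))"
    using 1 2 by (intro Bochner_Integration.integrable_add) auto
  thus ?thesis
  proof (rule Bochner_Integration.integrable_bound)
    have le1: "norm (Complex c s) powr (- p) \<le> c powr (- p)" for s
      using c p abs_Re_le_cmod[of "Complex c s"] by (intro powr_mono2') auto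
    have le2: "norm (Complex c s) powr (- p) \<le> \<bar>s\<bar> powr (- p)" if "\<bar>s\<bar> \<ge> 1" for s
      using that p abs_Im_le_cmod[of "Complex c s"] by (intro powr_mono2') auto
    have bound: "norm (Complex c s) powr (- p) \<le> indicator {-1..1} s * c powr (- p) + indicator {1..} s * s powr (- p)
      + indicator {1..} (- s) * (- s) powr (- p)" for s
    proof -
      have nonneg: "0 \<le> indicator {-1..1} s * c powr (- p)" "0 \<le> indicator {1..} s * s powr (- p)"
        "0 \<le> indicator {1..} (- s) * (- s) powr (- p)" by simp_all
      consider "s \<ge> 1" | "s \<le> -1" | "\<bar>s\<bar> < 1" by linarith
      thus ?thesis
      proof cases
        case 1
        hence "norm (Complex c s) powr (- p) \<le> indicator {1..} s * s powr (- p)" using le2[of s] by simp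
        with nonneg show ?thesis by linarith
      next
        case 2
        hence "norm (Complex c s) powr (- p) \<le> indicator {1..} (- s) * (- s) powr (- p)" using le2[of s] by simp
        with nonneg show ?thesis by linarith
      next
        case 3
        hence "s \<in> {-1..1}" by auto
        hence "norm (Complex c s) powr (- p) \<le> indicator {-1..1} s * c powr (- p)" using le1[of s] by simp
        with nonneg show ?thesis by linarith
      qed
    qed
    show "AE s in lborel. norm (norm (Complex c s) powr (- p)) \<le> norm (indicator {-1..1} s * c powr (- p)
      + indicator {1..} s * s powr (- p) + indicator {1..} (- s) * (- s) powr (- p))"
      using order_trans[OF bound abs_ge_self]
      by (intro AE_I2) (simp only: real_norm_def abs_of_nonneg[OF powr_ge_zero])
    have "continuous_on UNIV (\<lambda>s. norm (Complex c s) powr (- p))"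
      using c by (intro continuous_intros) (auto simp: complex_eq_iff)
    thus "(\<lambda>s. norm (Complex c s) powr (- p)) \<in> borel_measurable lborel"
      by (simp add: borel_measurable_continuous_onI)
  qed
qed

lemma line_powr_measurable:
  assumes "c > 0"
  shows "(\<lambda>s. Complex c s powr (- of_real a)) \<in> borel_measurable borel"
  using assms by (intro borel_measurable_continuous_onI continuous_intros) (auto simp: complex_nonpos_Reals_iff complex_eq_iff)

lemma one_minus_line_powr_measurable:
  assumes "c < 1"
  shows "(\<lambda>s. (1 - Complex c s) powr (- of_real a)) \<in> borel_measurable borel"
  using assms by (intro borel_measurable_continuous_onI continuous_intros) (auto simp: complex_nonpos_Reals_iff complex_eq_iff)

text \<open>After taking \<open>p\<close>-th roots this is \<open>x \<le> exp x\<close> at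
  \<open>x = c * u / p\<close>. It supplies the boundedness that Fourier inversion asks of a gamma
  density.\<close>

lemma powr_mult_exp_neg_bounded:
  fixes p c u :: real
  assumes p: "p > 0" and c: "c > 0" and u: "u \<ge> 0"
  shows "u powr p * exp (- c * u) \<le> (p / c) powr p"
proof -
  have "exp (- c * u) = exp (- c * u / p) powr p" using p by (simp add: powr_def)
  hence "u powr p * exp (- c * u) = (u * exp (- c * u / p)) powr p"
    using u by (simp add: powr_mult)
  also have "\<dots> \<le> (p / c) powr p"
  proof (rule powr_mono2)
    have "c * u / p \<le> exp (c * u / p)" using exp_ge_add_one_self[of "c * u / p"] by linarith
    thus "u * exp (- c * u / p) \<le> p / c" using p c by (simp add: exp_minus field_simps)
  qed (use p u in auto)
  finally show ?thesis .
qed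

text \<open>The factors are, up to \<open>Gamma a\<close> and \<open>Gamma b\<close>, Fourier
  transforms of the gamma functions \<open>h\<close> and \<open>g\<close> with rates
  \<open>c\<close> and \<open>1 - c\<close>. Parseval reduces the integral to that of
  \<open>h * g\<close>; there the rates add to 1, so \<open>c\<close> disappears. The condition
  \<open>a > 1\<close> makes \<open>h\<close> continuous at 0 and its transform integrable.\<close>

lemma cauchy_beta_line_integral:
  fixes a b c :: real
  assumes a: "a > 1" and b: "b > 0" and c: "0 < c" "c < 1"
  shows "(LINT s|lborel. Complex c s powr (- of_real a) * (1 - Complex c s) powr (- of_real b)) =
           of_real (2 * pi * Gamma (a + b - 1) / (Gamma a * Gamma b))"
proof -
  define h where "h = (\<lambda>u::real. indicator {0..} u * u powr (a - 1) * exp (- c * u))"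
  define g where "g = (\<lambda>v::real. indicator {0..} v * v powr (b - 1) * exp (- (1 - c) * v))"
  have [measurable]: "h \<in> borel_measurable borel" "g \<in> borel_measurable borel"
    unfolding h_def g_def by measurable
  note [measurable] = line_powr_measurable[OF c(1)]
  have G: "Gamma a > 0" "Gamma b > 0" using a b by (auto intro: Gamma_real_pos)
  have h_hat: "(LINT u|lborel. of_real (h u) * iexp (- s * u)) = of_real (Gamma a) * Complex c s powr (- of_real a)" for s
  proof -
    have "of_real (h u) * iexp (- s * u)
        = of_real (indicator {0..} u * u powr (a - 1)) * exp (- Complex c s * of_real u)" for u
      by (simp add: h_def Complex_eq mult_exp_exp algebra_simps flip: exp_of_real)
    thus ?thesis
      using complex_gamma_rate_has_bochner_integral[of a "Complex c s"] a c
      by (simp add: has_bochner_integral_iff)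
  qed
  have g_hat: "has_bochner_integral lborel (\<lambda>v. of_real (g v) * iexp (s * v)) (of_real (Gamma b) * (1 - Complex c s) powr (- of_real b))" for s
  proof -
    have "of_real (g v) * iexp (s * v)
        = of_real (indicator {0..} v * v powr (b - 1)) * exp (- (1 - Complex c s) * of_real v)" for v
      by (simp add: g_def Complex_eq mult_exp_exp algebra_simps flip: exp_of_real)
    thus ?thesis
      using complex_gamma_rate_has_bochner_integral[of b "1 - Complex c s"] b c by simp
  qed
  have g_int: "integrable lborel g"
    using gamma_rate_has_bochner_integral[of b "1 - c"] b c by (simp add: g_def has_bochner_integral_iff)
  have line_int: "integrable lborel (\<lambda>s. of_real (Gamma a) * Complex c s powr (- of_real a))"
  proof -
    have "norm (Complex c s powr (- of_real a)) = norm (Complex c s) powr (- a)" for s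
      by (simp add: norm_powr_real_powr')
    hence "integrable lborel (\<lambda>s. Complex c s powr (- of_real a))"
      using integrable_norm_line_powr[OF a c(1)] by (intro integrable_norm_cancel[of lborel "\<lambda>s. Complex c s powr _"]) auto
    thus ?thesis by simp
  qed
  have inv: "(LINT s|lborel. of_real (Gamma a) * Complex c s powr (- of_real a) * iexp (s * v)) = 2 * pi * h v" for v
    unfolding h_hat [symmetric]
  proof (rule fourier_inversion)
    show "integrable lborel h"
      using gamma_rate_has_bochner_integral[of a c] a c by (simp add: h_def has_bochner_integral_iff)
    \<comment> \<open>The convention \<open>0 powr p = 0\<close> lets \<open>max 0 u\<close> absorb
      the indicator; continuity at 0 then follows from \<open>a - 1 > 0\<close>.\<close>
    have "h = (\<lambda>u. max 0 u powr (a - 1) * exp (- c * u))" by (auto simp: h_def indicator_def fun_eq_iff max_def)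
    moreover have "continuous_on UNIV (\<lambda>u. max 0 u powr (a - 1) * exp (- c * u))"
      using a by (intro continuous_intros continuous_on_powr') auto
    ultimately show "continuous_on UNIV h" by simp
    show "\<bar>h u\<bar> \<le> ((a - 1) / c) powr (a - 1)" for u
      using powr_mult_exp_neg_bounded[of "a - 1" c u] a c by (auto simp: h_def indicator_def abs_mult)
    show "integrable lborel (\<lambda>s. LINT u|lborel. of_real (h u) * iexp (- s * u))"
      unfolding h_hat by (rule line_int)
  qed
  let ?H = "\<lambda>s v. of_real (Gamma a) * Complex c s powr (- of_real a) * (of_real (g v) * iexp (s * v))"
  have "integrable (lborel \<Otimes>\<^sub>M lborel) (\<lambda>(s, v). ?H s v)"
  proof (rule lborel_pair.Fubini_integrable)
    have "(\<lambda>s. LINT v|lborel. norm ((\<lambda>(s, v). ?H s v) (s, v)))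
       = (\<lambda>s. norm (of_real (Gamma a) * Complex c s powr (- of_real a)) * (LINT v|lborel. \<bar>g v\<bar>))"
      by (simp add: norm_mult)
    thus "integrable lborel (\<lambda>s. LINT v|lborel. norm ((\<lambda>(s, v). ?H s v) (s, v)))"
      using integrable_norm[OF line_int] by simp
    show "AE s in lborel. integrable lborel (\<lambda>v. (\<lambda>(s, v). ?H s v) (s, v))"
      using g_hat by (auto simp: has_bochner_integral_iff)
  qed measurable
  from lborel_pair.Fubini_integral[OF this]
  have "(LINT v|lborel. LINT s|lborel. ?H s v) = (LINT s|lborel. LINT v|lborel. ?H s v)" .
  also have "(\<lambda>s. LINT v|lborel. ?H s v) = (\<lambda>s. of_real (Gamma a * Gamma b) * (Complex c s powr (- of_real a) * (1 - Complex c s) powr (- of_real b)))"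
    unfolding integral_mult_right_zero using g_hat by (simp add: has_bochner_integral_iff mult_ac)
  \<comment> \<open>The inner integral over \<open>s\<close> is the inverse transform of
    \<open>h\<close> at \<open>v\<close>, with \<open>g v\<close> as a constant factor.\<close>
  also have "(\<lambda>v. LINT s|lborel. ?H s v) = (\<lambda>v. of_real (2 * pi * (h v * g v)))"
  proof
    fix v
    have "(LINT s|lborel. ?H s v) = (LINT s|lborel. of_real (g v) * (of_real (Gamma a) * Complex c s powr (- of_real a) * iexp (s * v)))"
      by (simp add: mult_ac)
    also have "\<dots> = of_real (2 * pi * (h v * g v))"
      unfolding integral_mult_right_zero inv by simp
    finally show "(LINT s|lborel. ?H s v) = of_real (2 * pi * (h v * g v))" .
  qed
  also have "(LINT v|lborel. complex_of_real (2 * pi * (h v * g v))) = of_real (2 * pi * (LINT v|lborel. h v * g v))"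
    by (simp only: integral_complex_of_real integral_mult_right_zero)
  also have "(LINT v|lborel. h v * g v) = Gamma (a + b - 1)"
  proof -
    have "h v * g v = indicator {0..} v * v powr (a + b - 1 - 1) * exp (- 1 * v)" for v
    proof -
      have "v powr (a - 1) * v powr (b - 1) = v powr (a + b - 1 - 1)"
        by (simp add: powr_add [symmetric] algebra_simps)
      moreover have "exp (- c * v) * exp (- (1 - c) * v) = exp (- 1 * v)"
        by (simp add: mult_exp_exp algebra_simps)
      moreover have "h v * g v = indicator {0..} v * (v powr (a - 1) * v powr (b - 1))
          * (exp (- c * v) * exp (- (1 - c) * v))"
        by (simp add: h_def g_def indicator_def)
      ultimately show ?thesis by (simp only:)
    qed
    thus ?thesis using gamma_rate_has_bochner_integral[of "a + b - 1" 1] a b by (simp add: has_bochner_integral_iff)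
  qed
  finally show ?thesis using G by (simp add: field_simps)
qed

section \<open>The incomplete beta function as a line integral\<close>

lemma set_integrable_inc_beta:
  assumes "a > 0" "b > (0::real)" "0 \<le> l" "u \<le> 1"
  shows "set_integrable lborel {l..u} (\<lambda>t. t powr (a - 1) * (1 - t) powr (b - 1))"
  using assms by (intro set_integrable_subset[OF integrable_Beta[of a b]]) auto

lemma Beta_real_pos:
  assumes "a > 0" "b > (0::real)"
  shows "Beta a b > 0"
  unfolding Beta_def using assms by (intro divide_pos_pos mult_pos_pos Gamma_real_pos) auto

lemma inc_beta_has_integral:
  assumes "a > 0" "b > (0::real)" "y \<le> 1"
  shows "((\<lambda>t. t powr (a - 1) * (1 - t) powr (b - 1)) has_integral Beta a b * inc_beta y a b) {0..y}"
proof -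
  have "Beta a b > 0" using assms by (intro Beta_real_pos)
  hence "Beta a b * inc_beta y a b = (LINT t:{0..y}|lborel. t powr (a - 1) * (1 - t) powr (b - 1))"
    by (simp add: inc_beta_def)
  thus ?thesis using set_borel_integral_eq_integral[OF set_integrable_inc_beta[of a b 0 y]] assms
    by (simp add: has_integral_iff)
qed

text \<open>Integrate the derivative of \<open>t powr a * (1 - t) powr b\<close> over
  \<open>{0..y}\<close> and normalize with
  \<open>(a + b) * Beta (a + 1) b = a * Beta a b\<close>.\<close>

lemma inc_beta_plus1_left:
  assumes a: "a > 0" and b: "b > (0::real)" and y: "0 < y" "y < 1"
  shows "inc_beta y a b = inc_beta y (a + 1) b +
           y powr a * (1 - y) powr b * (Gamma (a + b) / (Gamma (a + 1) * Gamma b))"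
proof -
  have a_int: "a \<notin> \<int>\<^sub>\<le>\<^sub>0" using a by (auto elim!: nonpos_Ints_cases)
  have "((\<lambda>t. a * (t powr (a - 1) * (1 - t) powr (b - 1)) - (a + b) * (t powr (a + 1 - 1) * (1 - t) powr (b - 1)))
      has_integral (y powr a * (1 - y) powr b - 0 powr a * (1 - 0) powr b)) {0..y}"
  \<comment> \<open>The derivative is needed only inside the interval: at 0 it can blow up when
    \<open>a < 1\<close>, while the antiderivative stays continuous.\<close>
  proof (rule fundamental_theorem_of_calculus_interior)
    show "continuous_on {0..y} (\<lambda>t. t powr a * (1 - t) powr b)"
      using a b y by (intro continuous_intros continuous_on_powr') auto
    fix t assume t: "t \<in> {0<..<y}"
    have "((\<lambda>t. t powr a * (1 - t) powr b) has_real_derivative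
        a * t powr (a - 1) * (1 - t) powr b - b * (1 - t) powr (b - 1) * t powr a) (at t)"
      using t y by (auto intro!: derivative_eq_intros simp: field_simps)
    moreover have "(1 - t) powr b = (1 - t) powr (b - 1) * (1 - t)" "t powr a = t powr (a - 1) * t"
      using t y by (simp_all add: powr_diff)
    ultimately show "((\<lambda>t. t powr a * (1 - t) powr b) has_vector_derivative
        a * (t powr (a - 1) * (1 - t) powr (b - 1)) - (a + b) * (t powr (a + 1 - 1) * (1 - t) powr (b - 1))) (at t)"
      by (simp add: has_real_derivative_iff_has_vector_derivative algebra_simps)
  qed (use y in auto)
  moreover have "((\<lambda>t. a * (t powr (a - 1) * (1 - t) powr (b - 1)) - (a + b) * (t powr (a + 1 - 1) * (1 - t) powr (b - 1)))
      has_integral (a * (Beta a b * inc_beta y a b) - (a + b) * (Beta (a + 1) b * inc_beta y (a + 1) b))) {0..y}"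
    using a b y by (intro has_integral_diff has_integral_mult_right inc_beta_has_integral) auto
  ultimately have "y powr a * (1 - y) powr b - 0 powr a * (1 - 0) powr b = a * (Beta a b * inc_beta y a b) - (a + b) * (Beta (a + 1) b * inc_beta y (a + 1) b)"
    by (rule has_integral_unique)
  hence "y powr a * (1 - y) powr b = a * (Beta a b * inc_beta y a b) - (a + b) * (Beta (a + 1) b * inc_beta y (a + 1) b)"
    by simp
  also have "(a + b) * (Beta (a + 1) b * inc_beta y (a + 1) b) = a * Beta a b * inc_beta y (a + 1) b"
    using Beta_plus1_left[OF a_int, of b] by (simp only: mult.assoc [symmetric])
  finally have "inc_beta y a b = inc_beta y (a + 1) b + y powr a * (1 - y) powr b * (1 / (a * Beta a b))"
    using a Beta_real_pos[OF a b] by (simp add: field_simps)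
  also have "1 / (a * Beta a b) = Gamma (a + b) / (Gamma (a + 1) * Gamma b)"
    using Gamma_plus1[OF a_int] by (simp add: Beta_def)
  finally show ?thesis .
qed

text \<open>Raising \<open>a\<close> by \<open>N\<close> multiplies the integrand by
  \<open>t ^ N \<le> y ^ N\<close>. The normalizing Beta values shrink too, but more slowly: the
  ratio of successive terms of \<open>y ^ N / Beta (a + N) b\<close> tends to
  \<open>y < 1\<close>.\<close>

lemma inc_beta_add_nat_tendsto_0:
  assumes a: "a > 0" and b: "b > (0::real)" and y: "0 < y" "y < 1"
  shows "(\<lambda>N. inc_beta y (a + real N) b) \<longlonglongrightarrow> 0"
proof -
  define x where "x = (\<lambda>N. y ^ N / Beta (a + real N) b)"
  have Beta_pos: "Beta (a + real N) b > 0" for N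
    using a b by (intro Beta_real_pos) auto
  \<comment> \<open>Any number strictly between \<open>y\<close> and 1 serves as ratio. The
    threshold \<open>N0\<close> comes from solving \<open>y * (a + N + b) \<le> m * (a + N)\<close>
    for \<open>N\<close> after discarding the positive term \<open>m * a\<close>.\<close>
  define m where "m = (1 + y) / 2"
  obtain N0 :: nat where N0: "real N0 > y * (a + b) / (m - y)" using reals_Archimedean2 by blast
  have "summable x"
  proof (rule summable_ratio_test)
    show "m < 1" using y by (simp add: m_def)
    fix N assume "N \<ge> N0"
    hence "y * (a + b) / (m - y) < real N" using N0 by linarith
    hence "y * (a + b) < real N * (m - y)" using y by (subst (asm) pos_divide_less_eq) (auto simp: m_def)
    moreover have "m * a > 0" using a y by (simp add: m_def)
    ultimately have le: "y * (a + real N + b) \<le> m * (a + real N)" by (simp add: algebra_simps)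
    have "(a + real N + b) * Beta (a + real N + 1) b = (a + real N) * Beta (a + real N) b"
      using a by (intro Beta_plus1_left) (auto elim!: nonpos_Ints_cases)
    hence "Beta (a + real (Suc N)) b = (a + real N) * Beta (a + real N) b / (a + real N + b)"
      using a b by (simp add: field_simps)
    hence "x (Suc N) = x N * (y * (a + real N + b) / (a + real N))"
      by (simp add: x_def mult_ac)
    also have "\<dots> \<le> x N * m"
      using le a y Beta_pos[of N] by (intro mult_left_mono) (auto simp: x_def field_simps)
    finally show "norm (x (Suc N)) \<le> m * norm (x N)"
      using Beta_pos[of N] Beta_pos[of "Suc N"] y by (simp add: x_def mult.commute)
  qed
  hence x0: "x \<longlonglongrightarrow> 0" by (rule summable_LIMSEQ_zero)
  define U where "U = (LINT t:{0..y}|lborel. t powr (a - 1) * (1 - t) powr (b - 1))"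
  have bounds: "0 \<le> inc_beta y (a + real N) b \<and> inc_beta y (a + real N) b \<le> x N * U" for N
  proof -
    have "(LINT t:{0..y}|lborel. t powr (a + real N - 1) * (1 - t) powr (b - 1))
        \<le> (LINT t:{0..y}|lborel. y ^ N * (t powr (a - 1) * (1 - t) powr (b - 1)))"
    proof (rule set_integral_mono)
      show "set_integrable lborel {0..y} (\<lambda>t. t powr (a + real N - 1) * (1 - t) powr (b - 1))"
        using a b y by (intro set_integrable_inc_beta) auto
      have "set_integrable lborel {0..y} (\<lambda>t. t powr (a - 1) * (1 - t) powr (b - 1))"
        using a b y by (intro set_integrable_inc_beta) auto
      thus "set_integrable lborel {0..y} (\<lambda>t. y ^ N * (t powr (a - 1) * (1 - t) powr (b - 1)))"
        by (rule set_integrable_mult_right)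
    next
      fix t assume t: "t \<in> {0..y}"
      have "t powr (a + real N - 1) = t ^ N * t powr (a - 1)"
        using t by (cases "t = 0") (auto simp: powr_add powr_diff powr_realpow)
      thus "t powr (a + real N - 1) * (1 - t) powr (b - 1) \<le> y ^ N * (t powr (a - 1) * (1 - t) powr (b - 1))"
        using t by (auto intro!: mult_right_mono power_mono simp: mult.assoc)
    qed
    hence "(LINT t:{0..y}|lborel. t powr (a + real N - 1) * (1 - t) powr (b - 1)) \<le> y ^ N * U"
      by (simp add: U_def)
    moreover have "(LINT t:{0..y}|lborel. t powr (a + real N - 1) * (1 - t) powr (b - 1)) \<ge> 0"
      unfolding set_lebesgue_integral_def by (intro integral_nonneg_AE) auto
    ultimately show ?thesis using Beta_pos[of N] by (simp add: inc_beta_def x_def divide_right_mono)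
  qed
  show ?thesis
  proof (rule tendsto_sandwich[of "\<lambda>_. 0" _ _ "\<lambda>N. x N * U"])
    show "(\<lambda>N. x N * U) \<longlonglongrightarrow> 0" using tendsto_mult_left_zero[OF x0] .
  qed (use bounds in \<open>auto intro: tendsto_const\<close>)
qed

text \<open>The substitution \<open>t = 1 - u\<close> maps \<open>{0..1-y}\<close> onto
  \<open>{y..1}\<close>, the complementary part of the full Beta integral.\<close>

lemma inc_beta_reflect:
  assumes a: "a > 0" and b: "b > (0::real)" and y: "0 \<le> y" "y \<le> 1"
  shows "inc_beta (1 - y) b a = 1 - inc_beta y a b"
proof -
  have "(LINT t:{0..1-y}|lborel. t powr (b - 1) * (1 - t) powr (a - 1))
      = (LINT t:{y..1}|lborel. t powr (a - 1) * (1 - t) powr (b - 1))"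
    unfolding set_lebesgue_integral_def
    by (subst lborel_integral_real_affine[of "- 1" _ 1])
       (auto intro!: Bochner_Integration.integral_cong simp: indicator_def)
  also have "\<dots> = integral {y..1} (\<lambda>t. t powr (a - 1) * (1 - t) powr (b - 1))"
    using a b y by (intro set_borel_integral_eq_integral set_integrable_inc_beta) auto
  also have "\<dots> = Beta a b - integral {0..y} (\<lambda>t. t powr (a - 1) * (1 - t) powr (b - 1))"
  proof -
    have "integral {0..y} (\<lambda>t. t powr (a - 1) * (1 - t) powr (b - 1)) + integral {y..1} (\<lambda>t. t powr (a - 1) * (1 - t) powr (b - 1))
        = integral {0..1} (\<lambda>t. t powr (a - 1) * (1 - t) powr (b - 1))"
      using y integrable_Beta'[OF a b] by (rule Henstock_Kurzweil_Integration.integral_combine)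
    thus ?thesis using has_integral_Beta_real[OF a b] by (simp add: has_integral_iff)
  qed
  also have "integral {0..y} (\<lambda>t. t powr (a - 1) * (1 - t) powr (b - 1)) = Beta a b * inc_beta y a b"
    using inc_beta_has_integral[OF a b y(2)] by (simp add: has_integral_iff)
  finally show ?thesis
    using Beta_real_pos[OF a b] unfolding inc_beta_def[of "1 - y"] Beta_commute[of b a]
    by (simp add: diff_divide_distrib)
qed

section \<open>The line integrand with a simple pole at \<open>y\<close>\<close>

lemma norm_line_diff_ge:
  assumes y: "0 \<le> y" and c: "c \<noteq> (y::real)"
  shows "norm (Complex c s) \<le> (1 + y / \<bar>c - y\<bar>) * norm (Complex c s - of_real y)"
proof -
  have "\<bar>c - y\<bar> \<le> norm (Complex c s - of_real y)"
    using abs_Re_le_cmod[of "Complex c s - of_real y"] by simp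
  hence "y \<le> y / \<bar>c - y\<bar> * norm (Complex c s - of_real y)"
    using mult_left_mono[of "\<bar>c - y\<bar>" _ "y / \<bar>c - y\<bar>"] y c by simp
  moreover have "norm (Complex c s) \<le> norm (Complex c s - of_real y) + y"
    using norm_triangle_ineq[of "Complex c s - of_real y" "of_real y"] y by simp
  ultimately show ?thesis by (simp add: algebra_simps)
qed

text \<open>The integrand as a function of the height \<open>s\<close>. As
  \<open>dt = \<i> ds\<close>, the \<open>\<i>\<close> in \<open>2 * pi * \<i>\<close> cancels, and
  the identities below carry the real factor \<open>1 / (2 * pi)\<close>.\<close>

definition beta_line :: "real \<Rightarrow> real \<Rightarrow> real \<Rightarrow> real \<Rightarrow> real \<Rightarrow> complex" where
  "beta_line a b y c s =
     Complex c s powr (- of_real a) * (1 - Complex c s) powr (- of_real b) / (Complex c s - of_real y)"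

lemma beta_line_measurable:
  assumes "0 < c" "c < 1"
  shows "beta_line a b y c \<in> borel_measurable borel"
proof -
  note [measurable] = line_powr_measurable[OF assms(1)] one_minus_line_powr_measurable[OF assms(2)]
  have [measurable]: "(\<lambda>s. Complex c s) \<in> borel_measurable borel"
    by (intro borel_measurable_continuous_onI continuous_intros)
  show ?thesis unfolding beta_line_def by measurable
qed

lemma norm_one_minus_line_powr_le:
  assumes "c < 1" "b > (0::real)"
  shows "norm (1 - Complex c s) powr (- b) \<le> (1 - c) powr (- b)"
  using assms abs_Re_le_cmod[of "1 - Complex c s"]
  by (intro powr_mono2') auto

lemma norm_beta_line:
  "norm (beta_line a b y c s) =
     norm (Complex c s) powr (- a) * norm (1 - Complex c s) powr (- b) * (1 / norm (Complex c s - of_real y))"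
  by (simp add: beta_line_def norm_mult norm_divide norm_powr_real_powr')

text \<open>On a line that avoids \<open>y\<close>, the factor \<open>1 / (t - y)\<close> is bounded
  by a multiple of \<open>1 / norm t\<close>. This extra power gives the exponent
  \<open>a + 1 > 1\<close>, so integrability holds for every \<open>a > 0\<close>.\<close>

lemma norm_beta_line_le:
  assumes b: "b > 0" and y: "0 < y" and c: "0 < c" "c < 1" "c \<noteq> y"
  shows "norm (beta_line a b y c s) \<le>
     (1 - c) powr (- b) * (1 + y / \<bar>c - y\<bar>) * norm (Complex c s) powr (- (a + 1))"
proof -
  let ?t = "Complex c s"
  have t0: "norm ?t > 0" using c by (simp add: complex_eq_iff)
  have d0: "norm (?t - of_real y) > 0" using c by (simp add: complex_eq_iff)
  have "1 / norm (?t - of_real y) \<le> (1 + y / \<bar>c - y\<bar>) / norm ?t"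
    using norm_line_diff_ge[of y c s] y c t0 d0 by (simp add: divide_simps mult_ac)
  hence "norm (beta_line a b y c s) \<le> norm ?t powr (- a) * (1 - c) powr (- b) * ((1 + y / \<bar>c - y\<bar>) / norm ?t)"
    using norm_one_minus_line_powr_le[OF c(2) b, of s]
    unfolding norm_beta_line by (intro mult_mono) auto
  also have "\<dots> = (1 - c) powr (- b) * (1 + y / \<bar>c - y\<bar>) * norm ?t powr (- (a + 1))"
    using t0 by (simp add: powr_diff powr_minus divide_simps)
  finally show ?thesis .
qed

lemma integrable_beta_line:
  assumes a: "a > 0" and b: "b > 0" and y: "0 < y" and c: "0 < c" "c < 1" "c \<noteq> y"
  shows "integrable lborel (beta_line a b y c)"
proof (rule Bochner_Integration.integrable_bound)
  show "integrable lborel (\<lambda>s. (1 - c) powr (- b) * (1 + y / \<bar>c - y\<bar>) * norm (Complex c s) powr (- (a + 1)))"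
    using integrable_norm_line_powr[of "a + 1" c] a c by (intro integrable_mult_right) auto
  show "AE s in lborel. norm (beta_line a b y c s) \<le>
      norm ((1 - c) powr (- b) * (1 + y / \<bar>c - y\<bar>) * norm (Complex c s) powr (- (a + 1)))"
    by (intro AE_I2 order_trans[OF norm_beta_line_le[OF b y c]]) (simp only: real_norm_def abs_ge_self)
qed (use beta_line_measurable[OF c(1,2)] in simp)

lemma line_powr_minus_plus1:
  assumes "0 < c"
  shows "Complex c s powr (- of_real a) = Complex c s * Complex c s powr (- of_real (a + 1))"
proof -
  have "- complex_of_real a = 1 + - of_real (a + 1)" by simp
  moreover have "Complex c s powr 1 = Complex c s" using assms by (simp add: powr_def complex_eq_iff)
  ultimately show ?thesis using assms by (metis powr_add)
qed

text \<open>Splitting \<open>t = y + (t - y)\<close> in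
  \<open>t powr (- a) = t * t powr (- (a + 1))\<close> gives \<open>y\<close> times the integrand at
  \<open>a + 1\<close> plus a term without pole. Cauchy's integral evaluates the latter, and its
  value matches the boundary term in \<open>inc_beta_plus1_left\<close>.\<close>

lemma inc_beta_minus_line_integral_plus1:
  assumes a: "a > 0" and b: "b > 0" and y: "0 < y" "y < 1" and c: "y < c" "c < 1"
  defines "D \<equiv> \<lambda>a. of_real (inc_beta y a b) -
     of_real (y powr a * (1 - y) powr b / (2 * pi)) * (LINT s|lborel. beta_line a b y c s)"
  shows "D a = D (a + 1)"
proof -
  let ?K = "\<lambda>s. Complex c s powr (- of_real (a + 1)) * (1 - Complex c s) powr (- of_real b)"
  have c0: "c > 0" using y c by simp
  have eq: "beta_line a b y c s = of_real y * beta_line (a + 1) b y c s + ?K s" for s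
  proof -
    have "Complex c s - of_real y \<noteq> 0" using c by (simp add: complex_eq_iff)
    moreover have "Complex c s = of_real y + (Complex c s - of_real y)" by simp
    ultimately show ?thesis
      unfolding beta_line_def line_powr_minus_plus1[OF c0, of s a]
      by (simp add: field_simps)
  qed
  have int: "integrable lborel (beta_line a b y c)" "integrable lborel (beta_line (a + 1) b y c)"
    using a b y c c0 by (auto intro!: integrable_beta_line)
  have "integrable lborel (\<lambda>s. beta_line a b y c s - of_real y * beta_line (a + 1) b y c s)"
    using int by simp
  hence "integrable lborel ?K" by (simp add: eq)
  hence "(LINT s|lborel. beta_line a b y c s) = of_real y * (LINT s|lborel. beta_line (a + 1) b y c s)
      + of_real (2 * pi * Gamma (a + b) / (Gamma (a + 1) * Gamma b))"
    using cauchy_beta_line_integral[of "a + 1" b c] a b c c0 int by (simp add: eq)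
  thus ?thesis unfolding D_def inc_beta_plus1_left[OF a b y]
    using y by (simp add: powr_add algebra_simps)
qed

text \<open>The difference \<open>D\<close> of the two sides is unchanged under
  \<open>a \<mapsto> a + 1\<close> and tends to 0 along these shifts, hence it is 0.\<close>

lemma inc_beta_eq_line_integral_right:
  assumes a: "a > 0" and b: "b > 0" and y: "0 < y" "y < 1" and c: "y < c" "c < 1"
  shows "of_real (inc_beta y a b) =
     of_real (y powr a * (1 - y) powr b / (2 * pi)) * (LINT s|lborel. beta_line a b y c s)"
proof -
  define D where "D = (\<lambda>a. of_real (inc_beta y a b) -
     of_real (y powr a * (1 - y) powr b / (2 * pi)) * (LINT s|lborel. beta_line a b y c s))"
  have c0: "c > 0" using y c by simp
  have const: "D (a + real N) = D a" for N
  proof (induction N)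
    case (Suc N)
    thus ?case using inc_beta_minus_line_integral_plus1[of "a + real N" b y c] a b y c
      by (simp add: D_def add_ac)
  qed simp
  define B where "B = (LINT s|lborel. norm (beta_line a b y c s))"
  have le: "norm (LINT s|lborel. beta_line (a + real N) b y c s) \<le> (1 / c) ^ N * B" for N
  proof -
    have "norm (LINT s|lborel. beta_line (a + real N) b y c s) \<le> (LINT s|lborel. norm (beta_line (a + real N) b y c s))"
      by (rule integral_norm_bound)
    also have "\<dots> \<le> (LINT s|lborel. (1 / c) ^ N * norm (beta_line a b y c s))"
    proof (rule integral_mono)
      fix s
      have "norm (Complex c s) > 0" using c0 by (simp add: complex_eq_iff)
      hence "norm (beta_line (a + real N) b y c s) = (1 / norm (Complex c s)) ^ N * norm (beta_line a b y c s)"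
      proof -
        assume t0: "norm (Complex c s) > 0"
        have "norm (Complex c s) powr (- (a + real N)) = norm (Complex c s) powr (- real N) * norm (Complex c s) powr (- a)"
          by (simp add: powr_add [symmetric] algebra_simps)
        also have "norm (Complex c s) powr (- real N) = (1 / norm (Complex c s)) ^ N"
          using t0 by (simp add: powr_minus powr_realpow power_one_over inverse_eq_divide)
        finally show ?thesis unfolding norm_beta_line by (simp only: mult.assoc)
      qed
      moreover have "1 / norm (Complex c s) \<le> 1 / c"
        using c0 abs_Re_le_cmod[of "Complex c s"] by (intro divide_left_mono) (auto intro: mult_pos_pos simp: complex_eq_iff)
      ultimately show "norm (beta_line (a + real N) b y c s) \<le> (1 / c) ^ N * norm (beta_line a b y c s)"
        by (simp only:) (intro mult_right_mono power_mono, auto)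
    qed (use a b y c c0 in \<open>auto intro!: integrable_beta_line integrable_norm\<close>)
    finally show ?thesis by (simp add: B_def)
  qed
  have "(\<lambda>N. of_real (y powr (a + real N) * (1 - y) powr b / (2 * pi)) * (LINT s|lborel. beta_line (a + real N) b y c s)) \<longlonglongrightarrow> 0"
  proof (rule Lim_null_comparison)
    \<comment> \<open>The prefactor contributes \<open>y ^ N\<close>, and
      \<open>norm t \<ge> c\<close> on the line contributes \<open>(1 / c) ^ N\<close>. Their
      product decays because the line lies to the right of \<open>y\<close>.\<close>
    have "(\<lambda>N. (y / c) ^ N) \<longlonglongrightarrow> 0" using y c by (intro LIMSEQ_realpow_zero) auto
    thus "(\<lambda>N. (y / c) ^ N * (y powr a * (1 - y) powr b / (2 * pi) * B)) \<longlonglongrightarrow> 0"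
      by (rule tendsto_mult_left_zero)
    have "norm (of_real (y powr (a + real N) * (1 - y) powr b / (2 * pi)) * (LINT s|lborel. beta_line (a + real N) b y c s))
        \<le> (y powr (a + real N) * (1 - y) powr b / (2 * pi)) * ((1 / c) ^ N * B)" for N
      unfolding norm_mult using le[of N] by (intro mult_mono) (auto simp del: of_real_mult of_real_divide)
    also have "(y powr (a + real N) * (1 - y) powr b / (2 * pi)) * ((1 / c) ^ N * B)
       = (y / c) ^ N * (y powr a * (1 - y) powr b / (2 * pi) * B)" for N
      using y by (simp add: powr_add powr_realpow power_divide mult_ac)
    finally show "eventually (\<lambda>N. norm (of_real (y powr (a + real N) * (1 - y) powr b / (2 * pi)) * (LINT s|lborel. beta_line (a + real N) b y c s))
       \<le> (y / c) ^ N * (y powr a * (1 - y) powr b / (2 * pi) * B)) sequentially"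
      by (intro always_eventually allI)
  qed
  moreover have "(\<lambda>N. complex_of_real (inc_beta y (a + real N) b)) \<longlonglongrightarrow> of_real 0"
    by (intro tendsto_of_real inc_beta_add_nat_tendsto_0 a b y)
  ultimately have "(\<lambda>N. D (a + real N)) \<longlonglongrightarrow> of_real 0 - 0"
    unfolding D_def by (intro tendsto_diff)
  hence "D a = 0" unfolding const by (simp add: LIMSEQ_const_iff)
  thus ?thesis by (simp add: D_def)
qed

text \<open>Under \<open>t \<mapsto> 1 - t\<close> the line moves to the right of
  \<open>1 - y\<close>, the exponents change places and the pole factor changes sign; the value is
  therefore \<open>- inc_beta (1 - y) (n / 2) a\<close> with \<open>b\<close> for
  \<open>n / 2\<close>.\<close>

lemma inc_beta_eq_line_integral_left:
  assumes a: "a > 0" and b: "b > 0" and y: "0 < y" "y < 1" and c: "0 < c" "c < y"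
  shows "of_real (inc_beta y a b - 1) =
     of_real (y powr a * (1 - y) powr b / (2 * pi)) * (LINT s|lborel. beta_line a b y c s)"
proof -
  have eq: "beta_line b a (1 - y) (1 - c) (- s) = - beta_line a b y c s" for s
  proof -
    have 1: "Complex (1 - c) (- s) = 1 - Complex c s" by (simp add: complex_eq_iff)
    have 2: "1 - Complex c s - of_real (1 - y) = - (Complex c s - of_real y)" by simp
    have 3: "1 - (1 - Complex c s) = Complex c s" by simp
    show ?thesis unfolding beta_line_def 1 2 3 by (simp only: mult.commute divide_minus_right)
  qed
  have "(LINT s|lborel. beta_line b a (1 - y) (1 - c) s) = - (LINT s|lborel. beta_line a b y c s)"
    by (subst lborel_integral_real_affine[of "- 1" _ 0]) (auto simp: eq)
  thus ?thesis
    using inc_beta_eq_line_integral_right[of b a "1 - y" "1 - c"] inc_beta_reflect[OF a b, of y] a b y c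
    by (simp add: algebra_simps)
qed

section \<open>The kernel of the noncentral t-distribution\<close>

text \<open>A positive number divided by a root with positive real part again has positive real
  part, so it is the principal root of its square. The argument of \<open>erfc\<close> thereby
  becomes a constant over \<open>csqrt t\<close>.\<close>

lemma csqrt_line:
  assumes c: "0 < c" and y: "0 < y"
  shows "csqrt (of_real y / (2 * Complex c s)) = of_real (sqrt (y / 2)) / csqrt (Complex c s)"
proof (rule csqrt_unique)
  let ?q = "csqrt (Complex c s)"
  have "Re ?q > 0" using c by (simp add: add_nonneg_pos)
  thus "0 < Re (of_real (sqrt (y / 2)) / ?q) \<or> Re (of_real (sqrt (y / 2)) / ?q) = 0 \<and> 0 \<le> Im (of_real (sqrt (y / 2)) / ?q)"
    using y by (intro disjI1) (auto simp: Re_divide intro!: divide_pos_pos mult_pos_pos add_pos_nonneg)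
  show "(of_real (sqrt (y / 2)) / ?q)\<^sup>2 = of_real y / (2 * Complex c s)"
    using y by (simp add: power_divide flip: of_real_power)
qed

lemma csqrt_line_power:
  assumes c: "0 < c"
  shows "1 / csqrt (Complex c s) ^ Suc k = Complex c s powr (- of_real ((real k + 1) / 2))"
proof -
  have t: "Complex c s \<noteq> 0" using c by (simp add: complex_eq_iff)
  have "csqrt (Complex c s) ^ Suc k = exp (of_nat (Suc k) * (1 / 2 * Ln (Complex c s)))"
    using t by (simp only: exp_of_nat_mult csqrt_conv_powr powr_def if_False)
  moreover have "Complex c s powr (- of_real ((real k + 1) / 2)) = exp (- (of_nat (Suc k) * (1 / 2 * Ln (Complex c s))))"
    using t by (simp add: powr_def algebra_simps)
  ultimately show ?thesis by (simp only: exp_minus inverse_eq_divide)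
qed

text \<open>With \<open>w = \<delta> * sqrt (y / 2) / csqrt t\<close> the numerator of the kernel is
  \<open>exp (w^2) * erfc w\<close>. The term \<open>w ^ k\<close> and the factor
  \<open>1 / csqrt t\<close> combine to the power \<open>- (k + 1) / 2\<close> of
  \<open>t\<close>.\<close>

lemma nct_kernel_line_sums:
  assumes c: "0 < c" and y: "0 < y"
  shows "(\<lambda>k. of_real (mills_coeff k * (\<delta> * sqrt (y / 2)) ^ k) * beta_line ((real k + 1) / 2) (n / 2) y c s) sums
           (nct_kernel n \<delta> y (Complex c s) / (Complex c s - of_real y))"
proof -
  let ?t = "Complex c s" and ?q = "csqrt (Complex c s)"
  let ?w = "of_real (\<delta> * sqrt (y / 2)) / ?q"
  have t: "?t \<noteq> 0" using c by (simp add: complex_eq_iff)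
  have w: "of_real \<delta> * csqrt (of_real y / (2 * ?t)) = ?w"
    unfolding csqrt_line[OF c y] by simp
  have w2: "1 / (2 * ?t) * of_real (\<delta>\<^sup>2 * y) = ?w\<^sup>2"
  proof -
    have "(\<delta> * sqrt (y / 2))\<^sup>2 = \<delta>\<^sup>2 * y / 2" using y by (simp add: power_mult_distrib)
    hence "(complex_of_real (\<delta> * sqrt (y / 2)))\<^sup>2 = of_real (\<delta>\<^sup>2 * y / 2)"
      by (simp only: of_real_power [symmetric])
    thus ?thesis by (simp only: power_divide power2_csqrt) simp
  qed
  define r where "r = (1 - ?t) powr (- of_real (n / 2)) / (?t - of_real y)"
  have "(\<lambda>k. of_real (mills_coeff k) * ?w ^ k * (1 / ?q * r)) sums (exp (?w\<^sup>2) * erfc ?w * (1 / ?q * r))"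
    by (intro sums_mult2 exp_square_mult_erfc_sums)
  also have "exp (?w\<^sup>2) * erfc ?w * (1 / ?q * r) = nct_kernel n \<delta> y ?t / (?t - of_real y)"
  proof -
    have "e * f * (1 / q * (p powr (- b) / D)) = e * f / (q * p powr b) / D" for e f q p b D :: complex
      by (simp add: powr_minus divide_inverse)
    thus ?thesis unfolding nct_kernel_def w w2 r_def .
  qed
  also have "(\<lambda>k. of_real (mills_coeff k) * ?w ^ k * (1 / ?q * r)) =
     (\<lambda>k. of_real (mills_coeff k * (\<delta> * sqrt (y / 2)) ^ k) * beta_line ((real k + 1) / 2) (n / 2) y c s)"
  proof
    fix k
    have "of_real (mills_coeff k) * ?w ^ k * (1 / ?q * r)
        = of_real (mills_coeff k * (\<delta> * sqrt (y / 2)) ^ k) * (1 / ?q ^ Suc k * r)"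
      by (simp add: power_divide mult_ac)
    also have "1 / ?q ^ Suc k * r = beta_line ((real k + 1) / 2) (n / 2) y c s"
      unfolding csqrt_line_power[OF c] beta_line_def r_def by (simp only: times_divide_eq_right)
    finally show "of_real (mills_coeff k) * ?w ^ k * (1 / ?q * r) = of_real (mills_coeff k * (\<delta> * sqrt (y / 2)) ^ k) * beta_line ((real k + 1) / 2) (n / 2) y c s" .
  qed
  finally show ?thesis .
qed

text \<open>Termwise integration is allowed because each term is bounded by a summable constant
  times one integrable function \<open>G\<close> of \<open>s\<close>.\<close>

lemma nct_kernel_line_integral:
  fixes n \<delta> y c :: real
  assumes n: "n > 0" and y: "0 < y" and c: "0 < c" "c < 1" "c \<noteq> y"
  defines "f \<equiv> \<lambda>k s. of_real (mills_coeff k * (\<delta> * sqrt (y / 2)) ^ k) * beta_line ((real k + 1) / 2) (n / 2) y c s"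
    and "g \<equiv> \<lambda>s. nct_kernel n \<delta> y (Complex c s) / (Complex c s - of_real y)"
  shows "integrable lborel g"
    and "(\<lambda>k. integral\<^sup>L lborel (f k)) sums integral\<^sup>L lborel g"
    and "summable (\<lambda>k. norm (integral\<^sup>L lborel (f k)))"
proof -
  define G where "G = (\<lambda>s. (1 - c) powr (- (n / 2)) * (1 + y / \<bar>c - y\<bar>) * norm (Complex c s) powr (- (3 / 2)))"
  \<comment> \<open>As \<open>norm t \<ge> c\<close> on the line, \<open>\<bar>\<rho>\<bar>\<close>
    bounds the modulus of the argument of \<open>erfc\<close>. Convergence at the larger radius
    \<open>\<bar>\<rho>\<bar> + 1\<close> then yields absolute convergence at
    \<open>\<rho>\<close>.\<close>
  define \<rho> where "\<rho> = \<delta> * sqrt (y / 2) / sqrt c"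
  have "summable (\<lambda>k. mills_coeff k * (\<bar>\<rho>\<bar> + 1) ^ k)"
    using exp_square_mult_erfc_sums[of "\<bar>\<rho>\<bar> + 1 :: real"] by (simp add: sums_iff)
  hence \<rho>_summ: "summable (\<lambda>k. norm (mills_coeff k * \<rho> ^ k))"
    by (rule powser_insidea) auto
  have G_int: "integrable lborel G"
    unfolding G_def using c by (intro integrable_mult_right integrable_norm_line_powr) auto
  have f_int: "integrable lborel (f k)" for k
    unfolding f_def using n y c by (intro integrable_mult_right integrable_beta_line) auto
  have le: "norm (f k s) \<le> norm (mills_coeff k * \<rho> ^ k) * G s" for k s
  proof -
    let ?C = "(1 - c) powr (- (n / 2)) * (1 + y / \<bar>c - y\<bar>)"
    have t: "norm (Complex c s) \<ge> c" using abs_Re_le_cmod[of "Complex c s"] c by simp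
    have "norm (beta_line ((real k + 1) / 2) (n / 2) y c s) \<le> ?C * norm (Complex c s) powr (- ((real k + 1) / 2 + 1))"
      using n y c by (intro norm_beta_line_le) auto
    \<comment> \<open>The exponent \<open>3 / 2\<close> is reserved for integrability in
      \<open>s\<close>; the remaining \<open>k / 2\<close> is estimated by \<open>c\<close> and
      turns into a geometric factor.\<close>
    also have "- ((real k + 1) / 2 + 1) = - (real k / 2) + - (3 / 2)" by (simp add: field_simps)
    also have "norm (Complex c s) powr (- (real k / 2) + - (3 / 2)) = norm (Complex c s) powr (- (real k / 2)) * norm (Complex c s) powr (- (3 / 2))"
      by (rule powr_add)
    also have "?C * \<dots> \<le> ?C * (c powr (- (real k / 2)) * norm (Complex c s) powr (- (3 / 2)))"
      using t c y by (intro mult_left_mono mult_right_mono powr_mono2') auto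
    also have "c powr (- (real k / 2)) = (1 / sqrt c) ^ k"
    proof -
      have "(1 / sqrt c) ^ k = (c powr (- (1 / 2))) ^ k" using c by (simp add: powr_minus powr_half_sqrt inverse_eq_divide)
      also have "\<dots> = c powr (- (1 / 2) * real k)" using c by (simp only: powr_powr [symmetric] powr_realpow powr_gt_zero)
      finally show ?thesis by simp
    qed
    also have "?C * ((1 / sqrt c) ^ k * norm (Complex c s) powr (- (3 / 2))) = (1 / sqrt c) ^ k * G s"
      by (simp only: G_def mult_ac)
    finally have "norm (f k s) \<le> \<bar>mills_coeff k * (\<delta> * sqrt (y / 2)) ^ k\<bar> * ((1 / sqrt c) ^ k * G s)"
      unfolding f_def norm_mult norm_of_real by (intro mult_left_mono) auto
    also have "\<dots> = norm (mills_coeff k * \<rho> ^ k) * G s"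
      using c by (simp add: \<rho>_def abs_mult power_divide power_mult_distrib power_abs)
    finally show ?thesis .
  qed
  have summ: "summable (\<lambda>k. LINT s|lborel. norm (f k s))"
  proof (rule summable_comparison_test')
    show "summable (\<lambda>k. norm (mills_coeff k * \<rho> ^ k) * (LINT s|lborel. G s))"
      by (intro summable_mult2 \<rho>_summ)
    fix k
    have "(LINT s|lborel. norm (f k s)) \<le> (LINT s|lborel. norm (mills_coeff k * \<rho> ^ k) * G s)"
      by (intro integral_mono integrable_norm f_int integrable_mult_right G_int le)
    thus "norm (LINT s|lborel. norm (f k s)) \<le> norm (mills_coeff k * \<rho> ^ k) * (LINT s|lborel. G s)"
      by simp
  qed
  have AEs: "AE s in lborel. summable (\<lambda>k. norm (f k s))"
  proof (rule AE_I2)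
    fix s
    have "norm (norm (f k s)) \<le> norm (mills_coeff k * \<rho> ^ k) * G s" for k using le[of k s] by simp
    thus "summable (\<lambda>k. norm (f k s))"
      using summable_comparison_test'[OF summable_mult2[OF \<rho>_summ, of "G s"], of 0 "\<lambda>k. norm (f k s)"] by blast
  qed
  have sum_f: "(\<lambda>s. \<Sum>k. f k s) = g"
    using nct_kernel_line_sums[OF c(1) y] unfolding f_def g_def by (intro ext) (simp add: sums_iff)
  show "integrable lborel g" "(\<lambda>k. integral\<^sup>L lborel (f k)) sums integral\<^sup>L lborel g"
    using integrable_suminf[OF f_int AEs summ] sums_integral[OF f_int AEs summ] unfolding sum_f by auto
  show "summable (\<lambda>k. norm (integral\<^sup>L lborel (f k)))"
    by (rule summable_comparison_test'[OF summ]) (simp add: integral_norm_bound)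
qed

text \<open>Here \<open>v a\<close> stands for the value of the normalized beta line integral, so
  that one statement covers both sides of the pole. Of \<open>y powr ((k + 1) / 2)\<close> one
  \<open>sqrt y\<close> stays in front and the rest comes from the \<open>k\<close>-th power of the
  series variable.\<close>

lemma nct_kernel_line_integral_eq:
  fixes n \<delta> y c :: real
  assumes n: "n > 0" and y: "0 < y" and c: "0 < c" "c < 1" "c \<noteq> y"
    and v: "\<And>a. a > 0 \<Longrightarrow> of_real (v a) = of_real (y powr a * (1 - y) powr (n / 2) / (2 * pi)) *
              (LINT s|lborel. beta_line a (n / 2) y c s)"
  defines "I \<equiv> LINT s|lborel. nct_kernel n \<delta> y (Complex c s) / (Complex c s - of_real y)"
  shows "(\<lambda>k. complex_of_real (mills_coeff k * (\<delta> / sqrt 2) ^ k * v ((real k + 1) / 2))) sums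
           (of_real (sqrt y * (1 - y) powr (n / 2) / (2 * pi)) * I)"
    and "summable (\<lambda>k. norm (mills_coeff k * (\<delta> / sqrt 2) ^ k * v ((real k + 1) / 2)))"
proof -
  let ?f = "\<lambda>k s. of_real (mills_coeff k * (\<delta> * sqrt (y / 2)) ^ k) * beta_line ((real k + 1) / 2) (n / 2) y c s"
  let ?C = "complex_of_real (sqrt y * (1 - y) powr (n / 2) / (2 * pi))"
  have eq: "?C * integral\<^sup>L lborel (?f k) = of_real (mills_coeff k * (\<delta> / sqrt 2) ^ k * v ((real k + 1) / 2))" for k
  proof -
    have "y powr ((real k + 1) / 2) = sqrt y ^ Suc k"
    proof -
      have "sqrt y ^ Suc k = (y powr (1 / 2)) ^ Suc k" using y by (simp add: powr_half_sqrt)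
      also have "\<dots> = y powr (1 / 2 * real (Suc k))" using y by (simp only: powr_powr [symmetric] powr_realpow powr_gt_zero)
      finally show ?thesis by (simp add: add.commute)
    qed
    moreover have "(\<delta> * sqrt (y / 2)) ^ k = (\<delta> / sqrt 2) ^ k * sqrt y ^ k"
      by (simp add: real_sqrt_divide power_mult_distrib power_divide)
    ultimately have "sqrt y * (1 - y) powr (n / 2) / (2 * pi) * (mills_coeff k * (\<delta> * sqrt (y / 2)) ^ k)
       = mills_coeff k * (\<delta> / sqrt 2) ^ k * (y powr ((real k + 1) / 2) * (1 - y) powr (n / 2) / (2 * pi))"
      by simp
    hence "?C * of_real (mills_coeff k * (\<delta> * sqrt (y / 2)) ^ k)
       = of_real (mills_coeff k * (\<delta> / sqrt 2) ^ k) * of_real (y powr ((real k + 1) / 2) * (1 - y) powr (n / 2) / (2 * pi))"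
      by (simp only: of_real_mult [symmetric])
    thus ?thesis using v[of "(real k + 1) / 2"]
      by (simp only: integral_mult_right_zero of_real_mult mult.assoc [symmetric]) (simp add: mult.assoc)
  qed
  show "(\<lambda>k. complex_of_real (mills_coeff k * (\<delta> / sqrt 2) ^ k * v ((real k + 1) / 2))) sums (?C * I)"
    unfolding eq [symmetric] I_def using n y c by (intro sums_mult nct_kernel_line_integral(2))
  have "summable (\<lambda>k. norm ?C * norm (integral\<^sup>L lborel (?f k)))"
    using n y c by (intro summable_mult nct_kernel_line_integral(3))
  hence "summable (\<lambda>k. norm (?C * integral\<^sup>L lborel (?f k)))"
    by (simp only: norm_mult)
  thus "summable (\<lambda>k. norm (mills_coeff k * (\<delta> / sqrt 2) ^ k * v ((real k + 1) / 2)))"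
    by (simp only: eq norm_of_real real_norm_def)
qed

text \<open>Even indices \<open>2 * j\<close> give the terms of \<open>nct_P\<close>, odd ones
  \<open>2 * j + 1\<close> the negated terms of \<open>nct_Q\<close>. Absolute summability makes
  both subseries converge, so they can be interleaved.\<close>

lemma nct_P_minus_nct_Q_sums:
  fixes n x \<delta> y :: real
  assumes y: "y = x\<^sup>2 / (n + x\<^sup>2)"
    and summ: "summable (\<lambda>k. norm (mills_coeff k * (\<delta> / sqrt 2) ^ k * inc_beta y ((real k + 1) / 2) (n / 2)))"
  shows "(\<lambda>k. 1 / 2 * exp (- (\<delta>\<^sup>2 / 2)) * (mills_coeff k * (\<delta> / sqrt 2) ^ k * inc_beta y ((real k + 1) / 2) (n / 2)))
           sums (nct_P n x \<delta> - nct_Q n x \<delta>)"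
proof -
  define f where "f = (\<lambda>k. mills_coeff k * (\<delta> / sqrt 2) ^ k * inc_beta y ((real k + 1) / 2) (n / 2))"
  have pow: "(\<delta> / sqrt 2) ^ (2 * j) = (\<delta>\<^sup>2 / 2) ^ j" for j
    by (simp add: power_mult power_divide)
  have f_even: "f (2 * j) = (\<delta>\<^sup>2 / 2) ^ j / fact j * inc_beta y (real j + 1 / 2) (n / 2)" for j
    unfolding f_def mills_coeff_even pow by (simp add: add_divide_distrib)
  have f_odd: "f (2 * j + 1) = - (\<delta> / sqrt 2 * ((\<delta>\<^sup>2 / 2) ^ j / Gamma (real j + 3 / 2)) * inc_beta y (real j + 1) (n / 2))" for j
  proof -
    have *: "(real (2 * j + 1) + 1) / 2 = real j + 1" by simp
    show ?thesis unfolding f_def mills_coeff_odd power_add pow * by (simp add: mult_ac)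
  qed
  have sub: "summable (\<lambda>j. f (g j))" if "inj g" for g
  proof -
    have "summable ((\<lambda>k. norm (f k)) \<circ> g)"
      using summ that by (intro summable_reindex) (auto simp: f_def)
    thus ?thesis by (intro summable_norm_cancel[of "\<lambda>j. f (g j)"]) (simp add: o_def)
  qed
  have E: "(\<lambda>j. f (2 * j)) sums (\<Sum>j. f (2 * j))" and O: "(\<lambda>j. f (2 * j + 1)) sums (\<Sum>j. f (2 * j + 1))"
    by (rule summable_sums, rule sub, simp add: inj_def)+
  have "(\<lambda>k. if even k then f (2 * (k div 2)) else f (2 * ((k - 1) div 2) + 1)) sums ((\<Sum>j. f (2 * j + 1)) + (\<Sum>j. f (2 * j)))"
    by (rule sums_if[OF O E])
  also have "(\<lambda>k. if even k then f (2 * (k div 2)) else f (2 * ((k - 1) div 2) + 1)) = f"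
    by (auto simp: fun_eq_iff elim!: oddE evenE)
  finally have f_sums: "(\<lambda>k. 1 / 2 * exp (- (\<delta>\<^sup>2 / 2)) * f k) sums (1 / 2 * exp (- (\<delta>\<^sup>2 / 2)) * ((\<Sum>j. f (2 * j + 1)) + (\<Sum>j. f (2 * j))))"
    by (rule sums_mult)
  have P: "nct_P n x \<delta> = 1 / 2 * exp (- (\<delta>\<^sup>2 / 2)) * (\<Sum>j. f (2 * j))"
    unfolding nct_P_def Let_def y [symmetric] f_even ..
  have Q: "nct_Q n x \<delta> = - (1 / 2 * exp (- (\<delta>\<^sup>2 / 2)) * (\<Sum>j. f (2 * j + 1)))"
  proof -
    have "(\<Sum>j. - f (2 * j + 1)) = - (\<Sum>j. f (2 * j + 1))"
      using O by (intro suminf_minus) (simp add: sums_iff)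
    thus ?thesis unfolding nct_Q_def Let_def y [symmetric] f_odd minus_minus by simp
  qed
  have "nct_P n x \<delta> - nct_Q n x \<delta> = 1 / 2 * exp (- (\<delta>\<^sup>2 / 2)) * ((\<Sum>j. f (2 * j + 1)) + (\<Sum>j. f (2 * j)))"
    unfolding P Q by (simp add: algebra_simps)
  thus ?thesis using f_sums by (simp only: f_def)
qed

section \<open>Both line integrals for the remainder\<close>

theorem lemma3p1:
  fixes n x \<delta> y c d :: real
  assumes "n > 0" and "x > 0" and "y = x\<^sup>2 / (n + x\<^sup>2)"
    and "0 < y" and "y < c" and "c < 1"
    and "0 < d" and "d < y" and "y < 1"
  shows
   "(nct_F n x \<delta> = 2 * nct_P n x \<delta> + nct_R n x \<delta>) \<and>
    (nct_R n x \<delta> = 1/2 * erfc (\<delta> / sqrt 2) + nct_Q n x \<delta> - nct_P n x \<delta>) \<and>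
    (vline_integrable c (\<lambda>t. nct_kernel n \<delta> y t / (t - of_real y))) \<and>
    (complex_of_real (nct_R n x \<delta>) =
        of_real (1/2 * erfc (\<delta> / sqrt 2)) -
        of_real (1/2 * exp (- (\<delta>\<^sup>2 / 2))) *
          (of_real (sqrt y * (1 - y) powr (n / 2)) / (2 * of_real pi * \<i>)) *
          vline_integral c (\<lambda>t. nct_kernel n \<delta> y t / (t - of_real y))) \<and>
    (vline_integrable d (\<lambda>t. nct_kernel n \<delta> y t / (of_real y - t))) \<and>
    (complex_of_real (nct_R n x \<delta>) =
        of_real (1/2 * exp (- (\<delta>\<^sup>2 / 2))) *
          (of_real (sqrt y * (1 - y) powr (n / 2)) / (2 * of_real pi * \<i>)) *
          vline_integral d (\<lambda>t. nct_kernel n \<delta> y t / (of_real y - t)))"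
proof -
  define h where "h = 1 / 2 * exp (- (\<delta>\<^sup>2 / 2))"
  define I where "I = (\<lambda>c. LINT s|lborel. nct_kernel n \<delta> y (Complex c s) / (Complex c s - of_real y))"
  define C where "C = complex_of_real (sqrt y * (1 - y) powr (n / 2) / (2 * pi))"
  define f where "f = (\<lambda>k. mills_coeff k * (\<delta> / sqrt 2) ^ k * inc_beta y ((real k + 1) / 2) (n / 2))"
  have R: "nct_R n x \<delta> = 1/2 * erfc (\<delta> / sqrt 2) - (nct_P n x \<delta> - nct_Q n x \<delta>)"
    by (simp add: nct_R_def)
  have "(\<lambda>k. complex_of_real (f k)) sums (C * I c)" and "summable (\<lambda>k. norm (f k))"
    unfolding f_def C_def I_def
    by (rule nct_kernel_line_integral_eq[where v = "\<lambda>a. inc_beta y a (n / 2)"];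
        use assms in \<open>auto intro!: inc_beta_eq_line_integral_right simp del: of_real_mult of_real_divide\<close>)+
  have PQ: "(\<lambda>k. h * f k) sums (nct_P n x \<delta> - nct_Q n x \<delta>)"
    unfolding h_def f_def using \<open>summable _\<close> by (intro nct_P_minus_nct_Q_sums assms) (simp add: f_def)
  have Ic: "complex_of_real (nct_P n x \<delta> - nct_Q n x \<delta>) = of_real h * (C * I c)"
    using sums_of_real[OF PQ, where 'a = complex] sums_mult[OF \<open>_ sums (C * I c)\<close>, of "of_real h"]
    by (simp add: sums_iff)
  \<comment> \<open>On the left line every beta value is lowered by 1. The total defect is the
    series of \<open>exp (w^2) * erfc w\<close> at \<open>w = \<delta> / sqrt 2\<close>, so
    uniqueness of sums links the two line integrals.\<close>
  have "(\<lambda>k. complex_of_real (mills_coeff k * (\<delta> / sqrt 2) ^ k * (inc_beta y ((real k + 1) / 2) (n / 2) - 1))) sums (C * I d)"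
    unfolding C_def I_def
    by (rule nct_kernel_line_integral_eq(1)[where v = "\<lambda>a. inc_beta y a (n / 2) - 1"];
        use assms in \<open>auto intro!: inc_beta_eq_line_integral_left simp del: of_real_mult of_real_divide of_real_diff\<close>)
  moreover have "(\<lambda>k. of_real (mills_coeff k * (\<delta> / sqrt 2) ^ k)) sums complex_of_real (exp (\<delta>\<^sup>2 / 2) * erfc (\<delta> / sqrt 2))"
    using exp_square_mult_erfc_sums[of "\<delta> / sqrt 2"] by (intro sums_of_real) (simp add: power_divide)
  ultimately have "(\<lambda>k. complex_of_real (f k)) sums (C * I d + of_real (exp (\<delta>\<^sup>2 / 2) * erfc (\<delta> / sqrt 2)))"
    using sums_add by (fastforce simp: f_def algebra_simps)
  with \<open>_ sums (C * I c)\<close> have cd: "C * I c = C * I d + of_real (exp (\<delta>\<^sup>2 / 2) * erfc (\<delta> / sqrt 2))"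
    by (rule sums_unique2)
  \<comment> \<open>The factor \<open>exp (- (\<delta>^2 / 2))\<close> in \<open>h\<close> cancels
    the exponential of the defect. What remains is exactly the \<open>erfc\<close> term of the first
    formula, which is why the second one has none.\<close>
  have h: "h * (exp (\<delta>\<^sup>2 / 2) * erfc (\<delta> / sqrt 2)) = 1 / 2 * erfc (\<delta> / sqrt 2)"
    by (simp add: h_def mult_exp_exp mult.assoc [symmetric])
  have Rc: "complex_of_real (nct_R n x \<delta>) = of_real (1 / 2 * erfc (\<delta> / sqrt 2)) - of_real h * (C * I c)"
    unfolding Ic [symmetric] of_real_diff [symmetric] R ..
  also have "of_real h * (C * I c) = of_real h * (C * I d) + of_real (h * (exp (\<delta>\<^sup>2 / 2) * erfc (\<delta> / sqrt 2)))"
    unfolding cd distrib_left of_real_mult ..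
  also have "of_real (1 / 2 * erfc (\<delta> / sqrt 2)) - \<dots> = - (of_real h * (C * I d))"
    unfolding h by simp
  finally have Rd: "complex_of_real (nct_R n x \<delta>) = - (of_real h * (C * I d))" .
  \<comment> \<open>The \<open>\<i>\<close> from the parametrization in
    \<open>vline_integral\<close> cancels the one in \<open>2 * pi * \<i>\<close>.\<close>
  have C: "of_real (sqrt y * (1 - y) powr (n / 2)) / (2 * of_real pi * \<i>) * (\<i> * z) = C * z" for z
    by (simp add: C_def)
  have int: "integrable lborel (\<lambda>s. nct_kernel n \<delta> y (Complex c' s) / (Complex c' s - of_real y))"
    if "c' \<in> {c, d}" for c'
    using assms that by (intro nct_kernel_line_integral(1)) auto
  have neg: "nct_kernel n \<delta> y t / (of_real y - t) = - (nct_kernel n \<delta> y t / (t - of_real y))" for t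
    by (metis minus_diff_eq divide_minus_right)
  show ?thesis
  proof (intro conjI)
    show "vline_integrable c (\<lambda>t. nct_kernel n \<delta> y t / (t - of_real y))"
      unfolding vline_integrable_def by (rule int) simp
    show "vline_integrable d (\<lambda>t. nct_kernel n \<delta> y t / (of_real y - t))"
      unfolding vline_integrable_def neg using int[of d] by simp
    show "complex_of_real (nct_R n x \<delta>) =
        of_real (1/2 * erfc (\<delta> / sqrt 2)) -
        of_real (1/2 * exp (- (\<delta>\<^sup>2 / 2))) *
          (of_real (sqrt y * (1 - y) powr (n / 2)) / (2 * of_real pi * \<i>)) *
          vline_integral c (\<lambda>t. nct_kernel n \<delta> y t / (t - of_real y))"
      unfolding vline_integral_def mult.assoc[of "of_real (1 / 2 * exp _)"] C
      unfolding Rc h_def I_def ..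
    show "complex_of_real (nct_R n x \<delta>) =
        of_real (1/2 * exp (- (\<delta>\<^sup>2 / 2))) *
          (of_real (sqrt y * (1 - y) powr (n / 2)) / (2 * of_real pi * \<i>)) *
          vline_integral d (\<lambda>t. nct_kernel n \<delta> y t / (of_real y - t))"
      unfolding vline_integral_def mult.assoc[of "of_real (1 / 2 * exp _)"] C neg
      unfolding Rd h_def I_def by simp
  qed (simp_all add: nct_F_def nct_R_def)
qed

end
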